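(* Trees on $n$ vertices with distinct chromatic symmetric functions form an antichain in $\mathcal{S}_n$; that is, if $T_1$ and $T_2$ are trees on $n$ vertices with $X_{T_1}\neq X_{T_2}$, then neither $T_1\geq_s T_2$ nor $T_2\geq_s T_1$.
   Context: All graphs are finite and simple. The chromatic symmetric function of a graph $G$ with vertices $v_1,\dots,v_n$ is $X_G=\sum_{\kappa}x_{\kappa(v_1)}\cdots x_{\kappa(v_n)}$, summed over all proper colorings $\kappa:V(G)\to\{1,2,3,\dots\}$; it is a homogeneous symmetric function of degree $n$ over $\mathbb{Q}$. Let $s_\lambda$ be the Schur symmetric functions; $[s_\lambda]F$ denotes the coefficient of $s_\lambda$ in $F$ expanded in this basis, and $F$ is Schur-positive if $[s_\lambda]F\ge 0$ for all $\lambda$. For connected graphs $G,H$ on $n$ vertices (for which $[s_{(1^n)}]X_G$ and $[s_{(1^n)}]X_H$ are positive), set $$X_s(G,H)=X_G-\frac{[s_{(1^n)}]X_G}{[s_{(1^n)}]X_H}X_H.$$ $\mathcal{S}_n$ is the poset whose elements are the equivalence classes of connected graphs on $n$ vertices under $G\sim H\iff X_G=X_H$, ordered by $G\geq_s H$ if and only if $X_s(G,H)$ is Schur-positive. *)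

theory Defs
  imports
    Complex_Main
    "HOL-Library.Multiset"
    "HOL-Library.FuncSet"
    "Graph_Theory.Digraph_Component"
begin

text \<open>
  A finite simple graph is a \<open>pair_graph\<close>: a finite, loop-free, symmetric set of pairs on a
  finite vertex set, an edge \<open>uv\<close> being represented by the two arcs \<open>(u, v)\<close> and \<open>(v, u)\<close>.
\<close>

definition connected_graphs :: "nat \<Rightarrow> 'a pair_pre_digraph set" where
  "connected_graphs n =
     {G. pair_graph G \<and> Digraph_Component.connected (with_proj G) \<and> card (pverts G) = n}"

text \<open>
  The constants \<open>forest\<close> and \<open>tree\<close> of \<^theory>\<open>Graph_Theory.Digraph_Component\<close> speak about directed
  cycles, and in a symmetric digraph every edge \<open>uv\<close> gives the directed cycle \<open>u, v, u\<close>. The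
  cycles of the undirected graph are the directed cycles of length at least 3.
\<close>

definition trees :: "nat \<Rightarrow> 'a pair_pre_digraph set" where
  "trees n =
     {G \<in> connected_graphs n. \<not> (\<exists>p. pre_digraph.cycle (with_proj G) p \<and> 3 \<le> length p)}"

text \<open>
  Formal power series over the rationals in the variables \<open>x\<^sub>1, x\<^sub>2, \<dots>\<close>, given by their
  coefficients. The monomial \<open>x\<^sub>i\<^sub>1 \<cdots> x\<^sub>i\<^sub>k\<close> is the multiset \<open>{#i\<^sub>1, \<dots>, i\<^sub>k#}\<close>; all coefficients of
  monomials that contain the index 0 vanish in the series considered here.
\<close>

type_synonym series = "nat multiset \<Rightarrow> rat"

definition proper_colorings :: "'a pair_pre_digraph \<Rightarrow> ('a \<Rightarrow> nat) set" where
  "proper_colorings G = {\<kappa> \<in> pverts G \<rightarrow>\<^sub>E {1..}. \<forall>(u, v) \<in> parcs G. \<kappa> u \<noteq> \<kappa> v}"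

definition chromatic_symmetric_function :: "'a pair_pre_digraph \<Rightarrow> series" where
  "chromatic_symmetric_function G M =
     of_nat (card {\<kappa> \<in> proper_colorings G. image_mset \<kappa> (mset_set (pverts G)) = M})"

definition is_partition :: "nat list \<Rightarrow> bool" where
  "is_partition \<mu> \<longleftrightarrow> sorted_wrt (\<ge>) \<mu> \<and> 0 \<notin> set \<mu>"

definition cells :: "nat list \<Rightarrow> (nat \<times> nat) set" where
  "cells \<mu> = {(i, j). i < length \<mu> \<and> j < \<mu> ! i}"

definition semistandard_tableaux :: "nat list \<Rightarrow> (nat \<times> nat \<Rightarrow> nat) set" where
  "semistandard_tableaux \<mu> =
     {T \<in> cells \<mu> \<rightarrow>\<^sub>E {1..}.
        (\<forall>i j k. (i, j) \<in> cells \<mu> \<and> (i, k) \<in> cells \<mu> \<and> j < k \<longrightarrow> T (i, j) \<le> T (i, k)) \<and>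
        (\<forall>i j k. (i, k) \<in> cells \<mu> \<and> (j, k) \<in> cells \<mu> \<and> i < j \<longrightarrow> T (i, k) < T (j, k))}"

definition schur :: "nat list \<Rightarrow> series" where
  "schur \<mu> M =
     of_nat (card {T \<in> semistandard_tableaux \<mu>. image_mset T (mset_set (cells \<mu>)) = M})"

definition schur_expansion :: "series \<Rightarrow> (nat list \<Rightarrow> rat) \<Rightarrow> bool" where
  "schur_expansion F c \<longleftrightarrow>
     finite {\<mu>. c \<mu> \<noteq> 0} \<and> (\<forall>\<mu>. c \<mu> \<noteq> 0 \<longrightarrow> is_partition \<mu>) \<and>
     (\<forall>M. F M = (\<Sum>\<mu> | c \<mu> \<noteq> 0. c \<mu> * schur \<mu> M))"

text \<open>
  The Schur functions form a basis of the symmetric functions, so the description below is proper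
  for every symmetric function of bounded degree. It is unspecified for other series.
\<close>

definition schur_coeff :: "nat list \<Rightarrow> series \<Rightarrow> rat" where
  "schur_coeff \<mu> F = (THE c. schur_expansion F c) \<mu>"

definition schur_positive :: "series \<Rightarrow> bool" where
  "schur_positive F \<longleftrightarrow> (\<forall>\<mu>. is_partition \<mu> \<longrightarrow> 0 \<le> schur_coeff \<mu> F)"

text \<open>The number \<open>n\<close> in \<open>X\<^sub>s(G, H)\<close> is the common number of vertices of \<open>G\<close> and \<open>H\<close>.\<close>

definition X_s :: "nat \<Rightarrow> 'a pair_pre_digraph \<Rightarrow> 'a pair_pre_digraph \<Rightarrow> series" where
  "X_s n G H M =
     chromatic_symmetric_function G M -
     schur_coeff (replicate n 1) (chromatic_symmetric_function G) /
     schur_coeff (replicate n 1) (chromatic_symmetric_function H) *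
     chromatic_symmetric_function H M"

definition graph_geq_s :: "nat \<Rightarrow> 'a pair_pre_digraph \<Rightarrow> 'a pair_pre_digraph \<Rightarrow> bool" where
  "graph_geq_s n G H \<longleftrightarrow> schur_positive (X_s n G H)"

definition csf_equiv :: "nat \<Rightarrow> 'a pair_pre_digraph rel" where
  "csf_equiv n =
     {(G, H). G \<in> connected_graphs n \<and> H \<in> connected_graphs n \<and>
        chromatic_symmetric_function G = chromatic_symmetric_function H}"

definition S_poset :: "nat \<Rightarrow> 'a pair_pre_digraph set set" where
  "S_poset n = connected_graphs n // csf_equiv n"

text \<open>
  As \<open>X_s\<close> depends on the graphs only through their chromatic symmetric functions, the choice of
  representatives is irrelevant.
\<close>

definition geq_s :: "nat \<Rightarrow> 'a pair_pre_digraph set \<Rightarrow> 'a pair_pre_digraph set \<Rightarrow> bool" where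
  "geq_s n A B \<longleftrightarrow> (\<exists>G \<in> A. \<exists>H \<in> B. graph_geq_s n G H)"

definition tree_classes :: "nat \<Rightarrow> 'a pair_pre_digraph set set" where
  "tree_classes n = (\<lambda>T. csf_equiv n `` {T}) ` trees n"

end

theory Submission
  imports
    Defs
    "HOL-Combinatorics.Transposition"
    "HOL-Computational_Algebra.Polynomial"
begin

text \<open>
  The number of semistandard tableaux of shape \<open>\<mu>\<close> with entries in \<open>{1..k}\<close> is a polynomial in
  \<open>k\<close> whose value at \<open>k = -1\<close> vanishes unless \<open>\<mu>\<close> is a single column. Applied to the Schur expansion of
  \<open>X\<^sub>T\<close>, whose specialization is the chromatic polynomial \<open>k (k - 1)\<^sup>n\<^sup>-\<^sup>1\<close> of a tree, this shows that the
  coefficient of the single column is \<open>2\<^sup>n\<^sup>-\<^sup>1\<close> for every tree. So \<open>X\<^sub>s(T\<^sub>1, T\<^sub>2)\<close> is the plain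
  difference of the two series, and its specializations at all \<open>k\<close> vanish. If it is Schur-positive, all
  its coefficients are zero, because every \<open>s\<^sub>\<mu>\<close> specializes to a positive number at \<open>k = n\<close>.
\<close>

section \<open>Tableaux as Gelfand--Tsetlin patterns\<close>

text \<open>Evaluation at -1 isolates the column by reciprocity: up to the sign (-1)^n, a Schur
  function of degree n takes there the number of tableaux of the conjugate shape with all entries 1,
  which is 1 if that shape is a single row and 0 otherwise. At the same point the chromatic
  polynomial counts acyclic orientations up to sign, and a tree with n - 1 edges has 2^(n-1) of
  them. Neither fact is quoted: the first comes out of the recursion that strips the largest entry
  off a tableau, the second out of the explicit polynomial.

  The larger obstacle is that \<open>schur_coeff\<close> is a definite description, so nothing is
  known about a coefficient until the series is shown to have exactly one Schur expansion.
  Uniqueness follows from triangularity of the Kostka numbers. Existence also needs the symmetry of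
  the Schur functions and of the chromatic symmetric function, since a triangular system fixes only
  the coefficients of monomials with weakly decreasing exponents. Tableaux are replaced by patterns
  because both the symmetry and the recursion become arithmetic on neighbouring levels.\<close>

definition row_length :: "nat list \<Rightarrow> nat \<Rightarrow> nat" where
  "row_length \<mu> r = (if r < length \<mu> then \<mu> ! r else 0)"

lemma mem_cells_iff: "(r, c) \<in> cells \<mu> \<longleftrightarrow> c < row_length \<mu> r"
  by (auto simp: cells_def row_length_def)

lemma cells_eq_Sigma: "cells \<mu> = Sigma {..<length \<mu>} (\<lambda>r. {..<row_length \<mu> r})"
  by (auto simp: cells_def row_length_def)

lemma finite_cells [simp]: "finite (cells \<mu>)"
  by (simp add: cells_eq_Sigma)

lemma row_length_eq_0: "length \<mu> \<le> r \<Longrightarrow> row_length \<mu> r = 0"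
  by (simp add: row_length_def)

lemma card_cells: "card (cells \<mu>) = sum_list \<mu>"
  by (simp add: cells_eq_Sigma row_length_def sum_list_sum_nth atLeast0LessThan)

lemma sum_row_length: "(\<Sum>r<length \<mu>. row_length \<mu> r) = sum_list \<mu>"
  by (simp add: row_length_def sum_list_sum_nth atLeast0LessThan)

lemma antimono_row_length:
  assumes "is_partition \<mu>"
  shows "antimono (row_length \<mu>)"
proof (rule antimonoI)
  fix r s :: nat
  assume "r \<le> s"
  then show "row_length \<mu> s \<le> row_length \<mu> r"
    using assms unfolding is_partition_def row_length_def
    by (cases "r = s") (auto simp: sorted_wrt_iff_nth_less)
qed

lemma row_length_pos_iff:
  assumes "is_partition \<mu>"
  shows "0 < row_length \<mu> r \<longleftrightarrow> r < length \<mu>"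
proof (cases "r < length \<mu>")
  case True
  then have "\<mu> ! r \<noteq> 0"
    using nth_mem[OF True] assms by (metis is_partition_def)
  then show ?thesis using True by (simp add: row_length_def)
qed (simp add: row_length_def)

lemma partition_eqI:
  assumes "is_partition \<mu>" "is_partition \<nu>" "row_length \<mu> = row_length \<nu>"
  shows "\<mu> = \<nu>"
proof -
  have "r < length \<mu> \<longleftrightarrow> r < length \<nu>" for r
    using row_length_pos_iff[OF assms(1), of r] row_length_pos_iff[OF assms(2), of r] assms(3)
    by simp
  then have len: "length \<mu> = length \<nu>"
    by (metis linorder_neqE_nat order_less_irrefl)
  show ?thesis
  proof (rule nth_equalityI[OF len])
    fix r assume "r < length \<mu>"
    then show "\<mu> ! r = \<nu> ! r"
      using fun_cong[OF assms(3), of r] len by (simp add: row_length_def)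
  qed
qed

text \<open>
  In the pattern of a tableau, \<open>g r j\<close> is the number of entries in row \<open>r\<close> that are at most \<open>j\<close>, so the
  shape \<open>f\<close> is the level \<open>k\<close>. The shape is a function on all rows, zero beyond the last one.
\<close>

definition gt_patterns :: "nat \<Rightarrow> (nat \<Rightarrow> nat) \<Rightarrow> (nat \<Rightarrow> nat \<Rightarrow> nat) set" where
  "gt_patterns k f =
     {g. (\<forall>r. g r 0 = 0) \<and> (\<forall>r j. g r j \<le> g r (Suc j)) \<and>
         (\<forall>r j. g (Suc r) (Suc j) \<le> g r j) \<and> (\<forall>r j. k \<le> j \<longrightarrow> g r j = f r)}"

lemma gt_patternsD:
  assumes "g \<in> gt_patterns k f"
  shows "g r 0 = 0" "g r j \<le> g r (Suc j)" "g (Suc r) (Suc j) \<le> g r j"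
    "k \<le> j \<Longrightarrow> g r j = f r"
  using assms by (auto simp: gt_patterns_def)

lemma gt_patterns_mono:
  assumes "g \<in> gt_patterns k f" "i \<le> j"
  shows "g r i \<le> g r j"
  using assms(2) gt_patternsD(2)[OF assms(1)] by (rule lift_Suc_mono_le[rotated])

lemma gt_patterns_le:
  assumes "g \<in> gt_patterns k f"
  shows "g r j \<le> f r"
  using gt_patterns_mono[OF assms, of j "max j k" r] gt_patternsD(4)[OF assms, of "max j k" r]
  by simp

section \<open>Bijection between bounded tableaux and patterns\<close>

definition bounded_tableaux :: "nat \<Rightarrow> nat list \<Rightarrow> (nat \<times> nat \<Rightarrow> nat) set" where
  "bounded_tableaux k \<mu> = {T \<in> semistandard_tableaux \<mu>. \<forall>x \<in> cells \<mu>. T x \<le> k}"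

lemma finite_bounded_tableaux [simp]: "finite (bounded_tableaux k \<mu>)"
proof (rule finite_subset)
  show "bounded_tableaux k \<mu> \<subseteq> cells \<mu> \<rightarrow>\<^sub>E {..k}"
    by (auto simp: bounded_tableaux_def semistandard_tableaux_def PiE_def)
qed (auto intro: finite_PiE)

definition row_count :: "nat list \<Rightarrow> (nat \<times> nat \<Rightarrow> nat) \<Rightarrow> nat \<Rightarrow> nat \<Rightarrow> nat" where
  "row_count \<mu> T r j = card {c. c < row_length \<mu> r \<and> T (r, c) \<le> j}"

lemma tableauD:
  assumes "T \<in> semistandard_tableaux \<mu>"
  shows "x \<in> cells \<mu> \<Longrightarrow> 1 \<le> T x"
    "c < row_length \<mu> r \<Longrightarrow> b \<le> c \<Longrightarrow> T (r, b) \<le> T (r, c)"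
    "c < row_length \<mu> r \<Longrightarrow> c < row_length \<mu> s \<Longrightarrow> r < s \<Longrightarrow> T (r, c) < T (s, c)"
    "x \<notin> cells \<mu> \<Longrightarrow> T x = undefined"
proof -
  have T: "T \<in> cells \<mu> \<rightarrow>\<^sub>E {1..}"
    using assms by (simp add: semistandard_tableaux_def)
  show "1 \<le> T x" if "x \<in> cells \<mu>"
    using PiE_mem[OF T that] by simp
  show "T x = undefined" if "x \<notin> cells \<mu>"
    using PiE_arb[OF T that] .
  show "T (r, b) \<le> T (r, c)" if "c < row_length \<mu> r" "b \<le> c"
    using assms that unfolding semistandard_tableaux_def mem_cells_iff
    by (cases "b = c") auto
  show "T (r, c) < T (s, c)" if "c < row_length \<mu> r" "c < row_length \<mu> s" "r < s"
    using assms that unfolding semistandard_tableaux_def mem_cells_iff by blast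
qed

lemma down_closed_eq_lessThan:
  fixes A :: "nat set"
  assumes "finite A" "\<And>x y. x \<in> A \<Longrightarrow> y \<le> x \<Longrightarrow> y \<in> A"
  shows "A = {..<card A}"
proof (cases "A = {}")
  case False
  have "A = {..Max A}"
    using assms False by (auto intro: Max_in)
  then show ?thesis
    by (metis card_atMost lessThan_Suc_atMost)
qed simp

text \<open>Weak increase along a row makes the entries at most \<open>j\<close> an initial segment.
  The resulting equivalence lets the counts and the entries determine each other, and
  \<open>tableau_of\<close> inverts it.\<close>

lemma less_row_count_iff:
  assumes "T \<in> semistandard_tableaux \<mu>"
  shows "c < row_count \<mu> T r j \<longleftrightarrow> c < row_length \<mu> r \<and> T (r, c) \<le> j"
proof -
  let ?A = "{c. c < row_length \<mu> r \<and> T (r, c) \<le> j}"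
  have "?A = {..<card ?A}"
    using tableauD(2)[OF assms] by (intro down_closed_eq_lessThan) (auto intro: order_trans)
  then show ?thesis
    unfolding row_count_def by blast
qed

definition tableau_of :: "nat list \<Rightarrow> (nat \<Rightarrow> nat \<Rightarrow> nat) \<Rightarrow> nat \<times> nat \<Rightarrow> nat" where
  "tableau_of \<mu> g = restrict (\<lambda>(r, c). LEAST j. c < g r j) (cells \<mu>)"

lemma tableau_of_le_iff:
  assumes "g \<in> gt_patterns k (row_length \<mu>)" "c < row_length \<mu> r"
  shows "tableau_of \<mu> g (r, c) \<le> j \<longleftrightarrow> c < g r j"
proof -
  have ex: "c < g r k"
    using assms gt_patternsD(4)[OF assms(1), of k r] by simp
  have "(LEAST j. c < g r j) \<le> j \<longleftrightarrow> c < g r j"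
    using LeastI[of "\<lambda>j. c < g r j", OF ex] Least_le[of "\<lambda>j. c < g r j" j]
      gt_patterns_mono[OF assms(1), of "LEAST j. c < g r j" j r] by force
  then show ?thesis
    using assms(2) by (simp add: tableau_of_def mem_cells_iff)
qed

text \<open>Strict columns turn into the diagonal inequalities of a pattern: above an entry at most
  \<open>Suc j\<close> stands an entry at most \<open>j\<close>. Weak rows need no inequality of
  their own, since the entries are recovered as first levels at which a row is long enough.\<close>

lemma bij_betw_row_count:
  assumes \<mu>: "is_partition \<mu>"
  shows "bij_betw (row_count \<mu>) (bounded_tableaux k \<mu>) (gt_patterns k (row_length \<mu>))"
proof (rule bij_betw_byWitness[where f' = "tableau_of \<mu>"])
  show "\<forall>T\<in>bounded_tableaux k \<mu>. tableau_of \<mu> (row_count \<mu> T) = T"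
  proof
    fix T assume "T \<in> bounded_tableaux k \<mu>"
    then have T: "T \<in> semistandard_tableaux \<mu>"
      by (simp add: bounded_tableaux_def)
    show "tableau_of \<mu> (row_count \<mu> T) = T"
    proof
      fix x :: "nat \<times> nat"
      obtain r c where x: "x = (r, c)" by force
      show "tableau_of \<mu> (row_count \<mu> T) x = T x"
      proof (cases "x \<in> cells \<mu>")
        case True
        then show ?thesis
          unfolding tableau_of_def x
          by (auto simp: less_row_count_iff[OF T] mem_cells_iff intro: Least_equality)
      next
        case False
        then show ?thesis
          using tableauD(4)[OF T] by (simp add: tableau_of_def)
      qed
    qed
  qed
  show "\<forall>g\<in>gt_patterns k (row_length \<mu>). row_count \<mu> (tableau_of \<mu> g) = g"
  proof (intro ballI ext)
    fix g r j assume g: "g \<in> gt_patterns k (row_length \<mu>)"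
    have "{c. c < row_length \<mu> r \<and> tableau_of \<mu> g (r, c) \<le> j} = {..<g r j}"
      using tableau_of_le_iff[OF g] gt_patterns_le[OF g, of r j] by auto
    then show "row_count \<mu> (tableau_of \<mu> g) r j = g r j"
      by (simp add: row_count_def)
  qed
  show "row_count \<mu> ` bounded_tableaux k \<mu> \<subseteq> gt_patterns k (row_length \<mu>)"
  proof
    fix g assume "g \<in> row_count \<mu> ` bounded_tableaux k \<mu>"
    then obtain T where T: "T \<in> semistandard_tableaux \<mu>" and le: "\<forall>x\<in>cells \<mu>. T x \<le> k"
      and g: "g = row_count \<mu> T"
      by (auto simp: bounded_tableaux_def)
    have "row_count \<mu> T r 0 = 0" for r
      using less_row_count_iff[OF T, of 0 r 0] tableauD(1)[OF T, of "(r, 0)"]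
      by (auto simp: mem_cells_iff)
    moreover have "row_count \<mu> T r j \<le> row_count \<mu> T r (Suc j)" for r j
      unfolding row_count_def by (intro card_mono) auto
    moreover have "row_count \<mu> T (Suc r) (Suc j) \<le> row_count \<mu> T r j" for r j
      unfolding row_count_def
    proof (intro card_mono)
      have "row_length \<mu> (Suc r) \<le> row_length \<mu> r"
        using antimono_row_length[OF \<mu>] by (simp add: antimono_iff_le_Suc)
      then show "{c. c < row_length \<mu> (Suc r) \<and> T (Suc r, c) \<le> Suc j}
          \<subseteq> {c. c < row_length \<mu> r \<and> T (r, c) \<le> j}"
        using tableauD(3)[OF T, of _ r "Suc r"] by force
    qed simp
    moreover have "row_count \<mu> T r j = row_length \<mu> r" if "k \<le> j" for r j
    proof -
      have "{c. c < row_length \<mu> r \<and> T (r, c) \<le> j} = {..<row_length \<mu> r}"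
        using le that by (auto simp: mem_cells_iff) (meson le_trans mem_cells_iff)
      then show ?thesis by (simp add: row_count_def)
    qed
    ultimately show "g \<in> gt_patterns k (row_length \<mu>)"
      by (simp add: gt_patterns_def g)
  qed
  show "tableau_of \<mu> ` gt_patterns k (row_length \<mu>) \<subseteq> bounded_tableaux k \<mu>"
  proof
    fix T assume "T \<in> tableau_of \<mu> ` gt_patterns k (row_length \<mu>)"
    then obtain g where g: "g \<in> gt_patterns k (row_length \<mu>)" and T: "T = tableau_of \<mu> g"
      by auto
    note le_iff = tableau_of_le_iff[OF g, folded T]
    have ge1: "1 \<le> T (r, c)" if "c < row_length \<mu> r" for r c
      using le_iff[OF that, of 0] gt_patternsD(1)[OF g, of r] by simp
    have row: "T (r, b) \<le> T (r, c)" if "c < row_length \<mu> r" "b < c" for r b c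
      using le_iff[of b r "T (r, c)"] le_iff[of c r "T (r, c)"] that by simp
    \<comment> \<open>Each row passed on the way up costs one level by the diagonal inequality.
      Taken at \<open>j = T (s, c)\<close>, this yields strictness between any two rows of a column,
      not only adjacent ones.\<close>
    have step: "\<exists>i<j. c < g r i" if "c < g s j" "r < s" for r s c j
      using that(2,1)
    proof (induction s arbitrary: j)
      case (Suc s)
      obtain i where j: "j = Suc i"
        using Suc.prems gt_patternsD(1)[OF g] by (cases j) auto
      then have i: "c < g s i"
        using Suc.prems gt_patternsD(3)[OF g, of s i] by simp
      show ?case
      proof (cases "r = s")
        case True
        then show ?thesis using i j by auto
      next
        case False
        then obtain i' where "i' < i" "c < g r i'"
          using Suc.IH[OF _ i] Suc.prems by auto
        then show ?thesis using j by (intro exI[of _ i']) simp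
      qed
    qed simp
    have col: "T (r, c) < T (s, c)"
      if rs: "r < s" and r: "c < row_length \<mu> r" and s: "c < row_length \<mu> s" for r s c
    proof -
      obtain i where "i < T (s, c)" "c < g r i"
        using step[OF _ rs, of c "T (s, c)"] le_iff[OF s, of "T (s, c)"] by auto
      then show ?thesis using le_iff[OF r, of i] by simp
    qed
    have "T (r, c) \<le> k" if "c < row_length \<mu> r" for r c
      using le_iff[OF that, of k] gt_patternsD(4)[OF g, of k r] that by simp
    moreover have "T \<in> cells \<mu> \<rightarrow>\<^sub>E {1..}"
      using ge1 by (auto simp: T tableau_of_def mem_cells_iff)
    ultimately show "T \<in> bounded_tableaux k \<mu>"
      using row col by (auto simp: bounded_tableaux_def semistandard_tableaux_def mem_cells_iff)
  qed
qed

lemma card_bounded_tableaux: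
  "is_partition \<mu> \<Longrightarrow> card (bounded_tableaux k \<mu>) = card (gt_patterns k (row_length \<mu>))"
  using bij_betw_row_count by (rule bij_betw_same_card)

section \<open>Contents of tableaux as partial sums\<close>

definition cumulative :: "nat multiset \<Rightarrow> nat \<Rightarrow> nat" where
  "cumulative M j = size (filter_mset (\<lambda>x. x \<le> j) M)"

lemma cumulative_Suc: "cumulative M (Suc j) = cumulative M j + count M (Suc j)"
proof -
  have "filter_mset (\<lambda>x. x \<le> Suc j) M
      = filter_mset (\<lambda>x. x \<le> j) M + replicate_mset (count M (Suc j)) (Suc j)"
    by (intro multiset_eqI) (auto simp: le_Suc_eq)
  then show ?thesis by (simp add: cumulative_def)
qed

lemma cumulative_0: "cumulative M 0 = count M 0"
proof -
  have "filter_mset (\<lambda>x. x \<le> 0) M = replicate_mset (count M 0) 0"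
    by (intro multiset_eqI) auto
  then show ?thesis by (simp add: cumulative_def)
qed

text \<open>Successive differences recover the multiplicities, so a content may be compared through
  its partial sums, which are the row sums of the levels of a pattern.\<close>

lemma cumulative_inject: "cumulative M = cumulative N \<longleftrightarrow> M = N"
proof
  assume eq: "cumulative M = cumulative N"
  show "M = N"
  proof (rule multiset_eqI)
    fix x
    show "count M x = count N x"
      using cumulative_0[of M] cumulative_0[of N] cumulative_Suc[of M "x - 1"]
        cumulative_Suc[of N "x - 1"] eq
      by (cases x) simp_all
  qed
qed simp

lemma count_image_mset_set:
  "finite A \<Longrightarrow> count (image_mset f (mset_set A)) x = card {a \<in> A. f a = x}"
  by (simp add: count_image_mset' flip: card_eq_sum) (simp add: eq_commute)

lemma cumulative_image_mset_set:
  "finite A \<Longrightarrow> cumulative (image_mset f (mset_set A)) j = card {a \<in> A. f a \<le> j}"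
  by (simp add: cumulative_def filter_mset_image_mset)

lemma cumulative_content:
  "cumulative (image_mset T (mset_set (cells \<mu>))) j = (\<Sum>r<length \<mu>. row_count \<mu> T r j)"
proof -
  have "{x \<in> cells \<mu>. T x \<le> j}
      = Sigma {..<length \<mu>} (\<lambda>r. {c. c < row_length \<mu> r \<and> T (r, c) \<le> j})"
    by (auto simp: cells_eq_Sigma)
  then show ?thesis
    by (simp add: cumulative_image_mset_set row_count_def)
qed

text \<open>The level \<open>k\<close> may be any bound on the entries of \<open>M\<close>. This
  freedom allows one common \<open>k\<close> for a content and its image under a swap.\<close>

lemma schur_eq_card_gt_patterns:
  assumes \<mu>: "is_partition \<mu>" and k: "\<forall>x \<in># M. x \<le> k"
  shows "schur \<mu> M = of_nat (card {g \<in> gt_patterns k (row_length \<mu>).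
           \<forall>j. (\<Sum>r<length \<mu>. g r j) = cumulative M j})"
proof -
  let ?c = "\<lambda>T. image_mset T (mset_set (cells \<mu>))"
  have eq: "{T \<in> semistandard_tableaux \<mu>. ?c T = M} = {T \<in> bounded_tableaux k \<mu>. ?c T = M}"
    using k by (auto simp: bounded_tableaux_def)
  have iff: "?c T = M \<longleftrightarrow> (\<forall>j. (\<Sum>r<length \<mu>. row_count \<mu> T r j) = cumulative M j)" for T
    using cumulative_inject[of "?c T" M] by (auto simp: cumulative_content fun_eq_iff)
  have "bij_betw (row_count \<mu>) {T \<in> bounded_tableaux k \<mu>. ?c T = M}
      {g \<in> gt_patterns k (row_length \<mu>). \<forall>j. (\<Sum>r<length \<mu>. g r j) = cumulative M j}"
    using bij_betw_row_count[OF \<mu>, of k] unfolding bij_betw_def iff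
    by (auto simp: inj_on_def)
  then show ?thesis
    unfolding schur_def eq by (simp add: bij_betw_same_card)
qed

section \<open>Symmetry of the Schur functions\<close>

definition toggle_low :: "nat \<Rightarrow> (nat \<Rightarrow> nat \<Rightarrow> nat) \<Rightarrow> nat \<Rightarrow> nat" where
  "toggle_low m g r = max (g r m) (g (Suc r) (Suc (Suc m)))"

text \<open>Row 0 has no row above it, so its case repeats the bound from level
  \<open>m + 2\<close>.\<close>

definition toggle_high :: "nat \<Rightarrow> (nat \<Rightarrow> nat \<Rightarrow> nat) \<Rightarrow> nat \<Rightarrow> nat" where
  "toggle_high m g r =
     min (g r (Suc (Suc m))) (case r of 0 \<Rightarrow> g 0 (Suc (Suc m)) | Suc s \<Rightarrow> g s m)"

text \<open>
  The interlacing conditions confine the entry \<open>g r (Suc m)\<close> to an interval that depends on the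
  levels \<open>m\<close> and \<open>m + 2\<close> only. Reflecting every entry of the level in its interval is the
  Bender--Knuth involution.
\<close>

definition toggle :: "nat \<Rightarrow> (nat \<Rightarrow> nat \<Rightarrow> nat) \<Rightarrow> nat \<Rightarrow> nat \<Rightarrow> nat" where
  "toggle m g r = (g r)(Suc m := toggle_low m g r + toggle_high m g r - g r (Suc m))"

text \<open>These bounds make the truncated subtraction in \<open>toggle\<close> exact.\<close>

lemma toggle_bounds:
  assumes "g \<in> gt_patterns k f"
  shows "toggle_low m g r \<le> g r (Suc m)" "g r (Suc m) \<le> toggle_high m g r"
  using gt_patternsD(2,3)[OF assms]
  by (auto simp: toggle_low_def toggle_high_def split: nat.split)

lemma toggle_other: "j \<noteq> Suc m \<Longrightarrow> toggle m g r j = g r j"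
  by (simp add: toggle_def)

lemma toggle_plus:
  assumes "g \<in> gt_patterns k f"
  shows "toggle m g r (Suc m) + g r (Suc m) = toggle_low m g r + toggle_high m g r"
  using toggle_bounds[OF assms, where m = m and r = r] by (simp add: toggle_def)

lemma toggle_toggle:
  assumes "g \<in> gt_patterns k f"
  shows "toggle m (toggle m g) = g"
proof (intro ext)
  fix r j
  have "toggle_low m (toggle m g) r = toggle_low m g r"
    "toggle_high m (toggle m g) r = toggle_high m g r"
    by (auto simp: toggle_low_def toggle_high_def toggle_other split: nat.split)
  then show "toggle m (toggle m g) r j = g r j"
    using toggle_plus[OF assms, of m r] by (auto simp: toggle_def[of m "toggle m g"] toggle_other)
qed

text \<open>\<open>Suc m < k\<close> leaves the levels from \<open>k\<close> on, which carry the
  shape, untouched.\<close>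

lemma toggle_in_gt_patterns:
  assumes g: "g \<in> gt_patterns k f" and "Suc m < k"
  shows "toggle m g \<in> gt_patterns k f"
proof -
  have b: "toggle_low m g r \<le> toggle m g r (Suc m)" "toggle m g r (Suc m) \<le> toggle_high m g r"
    for r
    using toggle_bounds[OF g, where m = m and r = r] by (auto simp: toggle_def)
  have b': "g r m \<le> toggle m g r (Suc m)" "toggle m g r (Suc m) \<le> g r (Suc (Suc m))"
    "toggle m g (Suc r) (Suc m) \<le> g r m" "g (Suc r) (Suc (Suc m)) \<le> toggle m g r (Suc m)" for r
    using b[of r] b[of "Suc r"] by (simp_all add: toggle_low_def toggle_high_def)
  have "toggle m g r j \<le> toggle m g r (Suc j)" for r j
    using b'(1,2)[of r] gt_patternsD(2)[OF g, of r j]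
    by (cases "j = m"; cases "j = Suc m") (simp_all add: toggle_other)
  moreover have "toggle m g (Suc r) (Suc j) \<le> toggle m g r j" for r j
    using b'(3,4)[of r] gt_patternsD(3)[OF g, of r j]
    by (cases "j = m"; cases "j = Suc m") (simp_all add: toggle_other)
  ultimately show ?thesis
    using g \<open>Suc m < k\<close> by (auto simp: gt_patterns_def toggle_other)
qed

text \<open>The lower end for row \<open>r\<close> and the upper end for row \<open>r + 1\<close>
  are the maximum and the minimum of the same two numbers, \<open>g r m\<close> and
  \<open>g (Suc r) (Suc (Suc m))\<close>, so together they give the sum of both. The two unpaired
  ends are harmless: row 0 is bounded above by \<open>g 0 (Suc (Suc m))\<close>, and below the last
  row everything is 0.\<close>

lemma sum_toggle_interval:
  assumes "g \<in> gt_patterns k f" "\<And>r. n \<le> r \<Longrightarrow> f r = 0"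
  shows "(\<Sum>r<n. toggle_low m g r + toggle_high m g r) = (\<Sum>r<n. g r m + g r (Suc (Suc m)))"
proof (cases n)
  case (Suc n')
  \<comment> \<open>The extra terms account for the lower end of row \<open>i\<close>, whose partner
    belongs to the next row.\<close>
  have step: "(\<Sum>r<Suc i. toggle_low m g r + toggle_high m g r) + g i m
      = (\<Sum>r<Suc i. g r m + g r (Suc (Suc m))) + toggle_low m g i" for i
    by (induction i) (auto simp: toggle_low_def toggle_high_def)
  moreover have "toggle_low m g n' = g n' m"
    using gt_patterns_le[OF assms(1), of n "Suc (Suc m)"] assms(2)[of n] Suc
    by (simp add: toggle_low_def)
  ultimately show ?thesis
    using step[of n'] unfolding Suc by simp
qed simp

lemma sum_toggle:
  assumes "g \<in> gt_patterns k f" "\<And>r. n \<le> r \<Longrightarrow> f r = 0"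
  shows "(\<Sum>r<n. toggle m g r (Suc m)) + (\<Sum>r<n. g r (Suc m))
    = (\<Sum>r<n. g r m) + (\<Sum>r<n. g r (Suc (Suc m)))"
  using sum_toggle_interval[OF assms] by (simp add: toggle_plus[OF assms(1)] flip: sum.distrib)

abbreviation swap_adjacent :: "nat \<Rightarrow> nat \<Rightarrow> nat" where
  "swap_adjacent m \<equiv> transpose (Suc m) (Suc (Suc m))"

text \<open>Exchanging two adjacent multiplicities changes a single partial sum, and reflects it
  between its neighbours. \<open>toggle\<close> does the same to the row sums of a level.\<close>

lemma cumulative_swap_other:
  "j \<noteq> Suc m \<Longrightarrow> cumulative (image_mset (swap_adjacent m) M) j = cumulative M j"
  unfolding cumulative_def by (induction M) (auto simp: transpose_def)

lemma cumulative_swap: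
  "cumulative (image_mset (swap_adjacent m) M) (Suc m) + cumulative M (Suc m)
   = cumulative M m + cumulative M (Suc (Suc m))"
  unfolding cumulative_def by (induction M) (auto simp: transpose_def)

lemma toggle_content:
  assumes g: "g \<in> gt_patterns k (row_length \<mu>)"
    and M: "\<forall>j. (\<Sum>r<length \<mu>. g r j) = cumulative M j"
  shows "(\<Sum>r<length \<mu>. toggle m g r j) = cumulative (image_mset (swap_adjacent m) M) j"
proof (cases "j = Suc m")
  case True
  have "(\<Sum>r<length \<mu>. toggle m g r (Suc m)) + cumulative M (Suc m)
      = cumulative M m + cumulative M (Suc (Suc m))"
    using sum_toggle[OF g, of "length \<mu>" m] M by (simp add: row_length_eq_0)
  with cumulative_swap[of m M] True show ?thesis by simp
next
  case False
  then show ?thesis using M by (simp add: toggle_other cumulative_swap_other)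
qed

lemma image_swap_swap [simp]:
  "image_mset (swap_adjacent m) (image_mset (swap_adjacent m) M) = M"
  by (simp add: image_mset.compositionality)

lemma schur_swap:
  assumes \<mu>: "is_partition \<mu>"
  shows "schur \<mu> (image_mset (swap_adjacent m) M) = schur \<mu> M"
proof -
  let ?M = "image_mset (swap_adjacent m) M"
  \<comment> \<open>The summand \<open>Suc (Suc m)\<close> keeps both swapped values and the toggled
    level in range even when \<open>M\<close> has only small entries; the inserted 0 covers empty
    \<open>M\<close>.\<close>
  define k where "k = Suc (Suc m) + Max (insert 0 (set_mset M))"
  have "x \<le> k" if "x \<in># M" for x
  proof -
    have "x \<le> Max (insert 0 (set_mset M))" using that by simp
    then show ?thesis by (simp add: k_def)
  qed
  then have k: "\<forall>x\<in>#M. x \<le> k" "Suc m < k"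
    by (simp_all add: k_def)
  then have k': "\<forall>x\<in>#?M. x \<le> k"
    by (auto simp: transpose_def)
  let ?A = "\<lambda>M. {g \<in> gt_patterns k (row_length \<mu>).
      \<forall>j. (\<Sum>r<length \<mu>. g r j) = cumulative M j}"
  have sub: "toggle m ` ?A N \<subseteq> ?A (image_mset (swap_adjacent m) N)" for N
    using toggle_in_gt_patterns[OF _ k(2)] toggle_content by blast
  have "bij_betw (toggle m) (?A M) (?A ?M)"
    using sub[of M] sub[of ?M]
    by (intro bij_betw_byWitness[where f' = "toggle m"]) (auto simp: toggle_toggle)
  then show ?thesis
    by (simp add: schur_eq_card_gt_patterns[OF \<mu> k(1)] schur_eq_card_gt_patterns[OF \<mu> k']
        bij_betw_same_card)
qed

section \<open>Principal specializations\<close>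

text \<open>The shapes left after removing a horizontal strip from \<open>f\<close>: the possible
  levels directly below the level \<open>f\<close> of a pattern.\<close>

definition strips :: "(nat \<Rightarrow> nat) \<Rightarrow> (nat \<Rightarrow> nat) set" where
  "strips f = {h. \<forall>r. h r \<le> f r \<and> f (Suc r) \<le> h r}"

lemma stripsD: "h \<in> strips f \<Longrightarrow> h r \<le> f r" "h \<in> strips f \<Longrightarrow> f (Suc r) \<le> h r"
  by (auto simp: strips_def)

lemma antimono_strip: "h \<in> strips f \<Longrightarrow> antimono h"
  unfolding antimono_iff_le_Suc using stripsD order_trans by blast

lemma strip_eq_0: "h \<in> strips f \<Longrightarrow> f r = 0 \<Longrightarrow> h r = 0"
  using stripsD(1)[of h f r] by simp

lemma finite_strips:
  assumes "\<And>r. n \<le> r \<Longrightarrow> f r = 0"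
  shows "finite (strips f)"
proof (rule finite_subset)
  show "strips f \<subseteq> {h. \<forall>r. (r \<in> {..<n} \<longrightarrow> h r \<in> {..Max (f ` {..<n})}) \<and> (r \<notin> {..<n} \<longrightarrow> h r = 0)}"
  proof (intro subsetI CollectI allI conjI impI)
    fix h r assume h: "h \<in> strips f" and "r \<in> {..<n}"
    then have "h r \<le> f r" "f r \<le> Max (f ` {..<n})"
      by (auto simp: stripsD)
    then show "h r \<in> {..Max (f ` {..<n})}" by simp
  next
    fix h r assume "h \<in> strips f" "r \<notin> {..<n}"
    then show "h r = 0" using assms by (auto intro: strip_eq_0)
  qed
qed (intro finite_set_of_finite_funs finite_lessThan finite_atMost)

lemma gt_patterns_0: "gt_patterns 0 f = (if f = (\<lambda>_. 0) then {\<lambda>_ _. 0} else {})"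
  by (auto simp: gt_patterns_def fun_eq_iff)

text \<open>The branching rule: deleting the entries \<open>k + 1\<close> removes a horizontal strip
  and leaves a tableau with entries up to \<open>k\<close>. The \<open>min\<close> freezes the
  truncated pattern from level \<open>k\<close> on, as \<open>gt_patterns k\<close> demands.\<close>

lemma bij_betw_gt_patterns_Suc:
  "bij_betw (\<lambda>g. (\<lambda>r. g r k, \<lambda>r j. g r (min j k)))
     (gt_patterns (Suc k) f) (Sigma (strips f) (gt_patterns k))"
proof (rule bij_betw_byWitness[where f' = "\<lambda>(h, g) r j. if j \<le> k then g r j else f r"])
  show "\<forall>g\<in>gt_patterns (Suc k) f. (\<lambda>(h, g) r j. if j \<le> k then g r j else f r)
      (\<lambda>r. g r k, \<lambda>r j. g r (min j k)) = g"
    by (auto simp: fun_eq_iff not_le Suc_le_eq gt_patterns_def)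
  show "\<forall>x\<in>Sigma (strips f) (gt_patterns k).
      (\<lambda>r. ((\<lambda>(h, g) r j. if j \<le> k then g r j else f r) x) r k,
       \<lambda>r j. ((\<lambda>(h, g) r j. if j \<le> k then g r j else f r) x) r (min j k)) = x"
    by (auto simp: fun_eq_iff min_def gt_patterns_def)
  show "(\<lambda>g. (\<lambda>r. g r k, \<lambda>r j. g r (min j k))) ` gt_patterns (Suc k) f
      \<subseteq> Sigma (strips f) (gt_patterns k)"
  proof (safe)
    fix g assume g: "g \<in> gt_patterns (Suc k) f"
    show "(\<lambda>r. g r k) \<in> strips f"
      using gt_patterns_le[OF g] gt_patternsD(3)[OF g, of _ k] gt_patternsD(4)[OF g, of "Suc k"]
      by (auto simp: strips_def)
    have "g (Suc r) (min (Suc j) k) \<le> g r (min j k)" for r j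
      using gt_patternsD(3)[OF g, of r "min j k"] gt_patternsD(2)[OF g, of "Suc r" k]
      by (cases "j < k") simp_all
    then show "(\<lambda>r j. g r (min j k)) \<in> gt_patterns k (\<lambda>r. g r k)"
      using gt_patterns_mono[OF g] gt_patternsD(1)[OF g] by (auto simp: gt_patterns_def)
  qed
  show "(\<lambda>(h, g) r j. if j \<le> k then g r j else f r) ` Sigma (strips f) (gt_patterns k)
      \<subseteq> gt_patterns (Suc k) f"
  proof safe
    fix h g assume h: "h \<in> strips f" and g: "g \<in> gt_patterns k h"
    have "g r k = h r" for r using gt_patternsD(4)[OF g] by simp
    then have "(if Suc j \<le> k then g (Suc r) (Suc j) else f (Suc r)) \<le> (if j \<le> k then g r j else f r)"
      for r j
      using gt_patternsD(3)[OF g, of r j] stripsD[OF h, of r] by (cases "j = k") auto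
    moreover have "g r j \<le> f r" for r j
      using gt_patterns_le[OF g, of r j] stripsD(1)[OF h, of r] by simp
    ultimately show "(\<lambda>r j. if j \<le> k then g r j else f r) \<in> gt_patterns (Suc k) f"
      using gt_patternsD(1,2)[OF g] by (auto simp: gt_patterns_def)
  qed
qed

lemma finite_gt_patterns:
  "(\<And>r. n \<le> r \<Longrightarrow> f r = 0) \<Longrightarrow> finite (gt_patterns k f)"
proof (induction k arbitrary: f)
  case (Suc k)
  have "finite (Sigma (strips f) (gt_patterns k))"
    using finite_strips[of n f] Suc strip_eq_0 by (intro finite_SigmaI) blast+
  then show ?case
    using bij_betw_finite[OF bij_betw_gt_patterns_Suc] by blast
qed (simp add: gt_patterns_0)

lemma card_gt_patterns_Suc:
  assumes "\<And>r. n \<le> r \<Longrightarrow> f r = 0"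
  shows "card (gt_patterns (Suc k) f) = (\<Sum>h\<in>strips f. card (gt_patterns k h))"
proof -
  have "\<forall>h\<in>strips f. finite (gt_patterns k h)"
    using assms strip_eq_0 by (intro ballI finite_gt_patterns[of n]) blast
  then show ?thesis
    using bij_betw_same_card[OF bij_betw_gt_patterns_Suc, of k f] finite_strips[of n f] assms
    by simp
qed

lemma card_gt_patterns_pos:
  assumes "antimono f" "\<And>r. n \<le> r \<Longrightarrow> f r = 0" "n \<le> k"
  shows "0 < card (gt_patterns k f)"
proof -
  \<comment> \<open>The superstandard pattern: row \<open>r\<close> is filled with
    \<open>r + 1\<close>, so it appears in full at level \<open>r + 1\<close>. With
    \<open>n \<le> k\<close> every nonempty row is present at level \<open>k\<close>.\<close>
  have "(\<lambda>r j. if r < j then f r else 0) \<in> gt_patterns k f"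
    using assms by (auto simp: gt_patterns_def antimono_iff_le_Suc)
  then show ?thesis
    using finite_gt_patterns[of n f k] assms(2) by (auto simp: card_gt_0_iff)
qed

section \<open>Polynomial antidifferences\<close>

lemma pcompose_power: "pcompose (p ^ n) q = pcompose p q ^ n"
  by (induction n) (simp_all add: pcompose_1 pcompose_mult)

text \<open>Over the rationals the forward difference reaches every leading term, and the remainder
  has smaller degree. Counting possibly nonzero coefficients instead of using the degree makes the
  zero polynomial the base case.\<close>

lemma poly_antidifference_aux:
  fixes q :: "rat poly"
  assumes "\<And>i. d \<le> i \<Longrightarrow> coeff q i = 0"
  shows "\<exists>p. pcompose p [:1, 1:] - p = q"
  using assms
proof (induction d arbitrary: q)
  case 0
  then have "q = 0" by (simp add: poly_eq_iff)
  then show ?case by (intro exI[of _ 0]) simp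
next
  case (Suc d)
  \<comment> \<open>The forward difference of x^(d+1) starts with (d+1) x^d, so this multiple
    cancels the coefficient of x^d in \<open>q\<close>.\<close>
  define p1 where "p1 = monom (coeff q d / of_nat (Suc d)) (Suc d)"
  define D where "D = pcompose p1 [:1, 1:] - p1"
  have D: "D = smult (coeff q d / of_nat (Suc d)) ([:1, 1:] ^ Suc d) - p1"
    by (simp add: D_def p1_def monom_altdef pcompose_smult pcompose_power pcompose_pCons
        del: power_Suc)
  have "coeff (q - D) i = 0" if "d \<le> i" for i
  proof (cases "i \<le> Suc d")
    case True
    then have "i = d \<or> i = Suc d" using that by auto
    then show ?thesis
      using Suc.prems[of "Suc d"] unfolding D p1_def
      by (auto simp: coeff_linear_poly_power simp del: power_Suc of_nat_Suc)
  next
    case False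
    then have "coeff ([:1, 1:] ^ Suc d :: rat poly) i = 0"
      using degree_power_le[of "[:1, 1:] :: rat poly" "Suc d"]
      by (intro coeff_eq_0) (simp del: power_Suc)
    then show ?thesis
      using False Suc.prems[of i] unfolding D p1_def by (simp del: power_Suc)
  qed
  then obtain p2 where "pcompose p2 [:1, 1:] - p2 = q - D"
    using Suc.IH[of "q - D"] by blast
  then have "pcompose (p1 + p2) [:1, 1:] - (p1 + p2) = q"
    by (simp add: pcompose_add D_def algebra_simps)
  then show ?case by blast
qed

lemma poly_antidifference:
  fixes q :: "rat poly"
  obtains p where "\<And>x. poly p (x + 1) = poly p x + poly q x" "poly p 0 = c"
proof -
  obtain p where p: "pcompose p [:1, 1:] - p = q"
    using poly_antidifference_aux[of "Suc (degree q)" q] by (auto simp: coeff_eq_0)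
  let ?p = "p + [:c - poly p 0:]"
  have "poly ?p (x + 1) = poly ?p x + poly q x" for x
    by (simp add: p[symmetric] poly_pcompose add.commute)
  then show ?thesis by (rule that) simp
qed

text \<open>
  A strip all of whose rows have length at most 1 is determined except for its box in the last
  row of \<open>f\<close>; adding or removing that box is a sign-reversing involution.
\<close>

lemma sum_sign_column_strips:
  assumes f: "\<And>r. n \<le> r \<Longrightarrow> f r = 0" and "0 < f 0"
  shows "(\<Sum>h | h \<in> strips f \<and> h 0 \<le> 1. (- 1) ^ (\<Sum>r<n. h r)) = (0 :: rat)"
    (is "(\<Sum>h \<in> ?H. ?s h) = 0")
proof -
  define m where "m = (LEAST r. f r = 0)"
  have "f m = 0"
    unfolding m_def by (rule LeastI[of _ n]) (simp add: f)
  moreover have "f r \<noteq> 0" if "r < m" for r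
    using not_less_Least[of r "\<lambda>r. f r = 0"] that unfolding m_def by simp
  ultimately obtain l where l: "0 < f l" "f (Suc l) = 0"
    using \<open>0 < f 0\<close> by (cases m) auto
  then have "l < n" using f[of l] by (cases "l < n") auto
  \<comment> \<open>Row \<open>l\<close> is the last nonempty row of \<open>f\<close>, so
    \<open>h l\<close> has lower bound 0 and upper bound at least 1. Interlacing compares
    \<open>h\<close> only with \<open>f\<close>, hence the flip disturbs no other row.\<close>
  define \<tau> where "\<tau> h = h(l := 1 - h l)" for h :: "nat \<Rightarrow> nat"
  have le1: "h l \<le> 1" if "h \<in> ?H" for h
    using antimonoD[OF antimono_strip, of h f 0 l] that by auto
  have mem: "\<tau> h \<in> ?H" and inv: "\<tau> (\<tau> h) = h" and sgn: "?s (\<tau> h) = - ?s h" if "h \<in> ?H" for h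
  proof -
    show "\<tau> h \<in> ?H"
      using that l unfolding strips_def \<tau>_def by auto
    show "\<tau> (\<tau> h) = h"
      using le1[OF that] by (auto simp: \<tau>_def fun_eq_iff)
    have "(\<Sum>r<n. g r) = g l + (\<Sum>r\<in>{..<n} - {l}. g r)" for g :: "nat \<Rightarrow> nat"
      using \<open>l < n\<close> by (intro sum.remove) auto
    moreover have "(\<Sum>r\<in>{..<n} - {l}. \<tau> h r) = (\<Sum>r\<in>{..<n} - {l}. h r)"
      by (intro sum.cong) (auto simp: \<tau>_def)
    moreover have "h l = 0 \<or> h l = 1" using le1[OF that] by linarith
    ultimately show "?s (\<tau> h) = - ?s h"
      by (auto simp: \<tau>_def)
  qed
  have "(\<Sum>h \<in> ?H. ?s h) = (\<Sum>h \<in> ?H. - ?s h)"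
    by (rule sum.reindex_bij_witness[of _ \<tau> \<tau>]) (use mem inv sgn in auto)
  then show ?thesis by (simp add: sum_negf)
qed

text \<open>Splitting off the empty strip \<open>h = f\<close> in the branching rule expresses the
  step from \<open>k\<close> to \<open>k + 1\<close> as a sum over smaller shapes, which is
  polynomial by induction, so the count is an antidifference. A nonempty shape has no pattern with
  \<open>k = 0\<close>, so going back from 0 to -1 gives minus the sum of the values of the smaller
  shapes; the sign-reversing involution identifies this with the claimed value.\<close>

lemma gt_patterns_polynomial:
  assumes "antimono f" "\<And>r. n \<le> r \<Longrightarrow> f r = 0"
  shows "\<exists>p :: rat poly. (\<forall>k. poly p (of_nat k) = of_nat (card (gt_patterns k f))) \<and>
           poly p (- 1) = (if f 0 \<le> 1 then (- 1) ^ (\<Sum>r<n. f r) else 0)"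
  using assms
proof (induction "\<Sum>r<n. f r" arbitrary: f rule: less_induct)
  case less
  have fin: "finite (strips f)"
    and card_Suc: "card (gt_patterns (Suc k) f) = (\<Sum>h\<in>strips f. card (gt_patterns k h))" for k
    using less.prems(2) by (blast intro: finite_strips card_gt_patterns_Suc)+
  have self: "f \<in> strips f"
    using less.prems(1) by (simp add: strips_def antimono_iff_le_Suc)
  show ?case
  proof (cases "f 0 = 0")
    case True
    then have f: "f = (\<lambda>_. 0)"
      using antimonoD[OF less.prems(1), of 0] by (auto simp: fun_eq_iff)
    have "strips f = {f}"
      by (auto simp: strips_def f fun_eq_iff)
    then have "card (gt_patterns k f) = 1" for k
      using card_gt_patterns_Suc[of 0 f] by (induction k) (auto simp: gt_patterns_0 f)
    then show ?thesis
      \<comment> \<open>The empty shape has exactly one pattern for every \<open>k\<close>.\<close>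
      by (intro exI[of _ 1]) (simp add: f)
  next
    case False
    define S where "S = strips f - {f}"
    define v where "v h = (if h 0 \<le> 1 then (- 1) ^ (\<Sum>r<n. h r) else 0 :: rat)"
      for h :: "nat \<Rightarrow> nat"
    have "\<exists>p :: rat poly. (\<forall>k. poly p (of_nat k) = of_nat (card (gt_patterns k h))) \<and>
        poly p (- 1) = v h" if "h \<in> S" for h
      unfolding v_def
    proof (rule less.hyps)
      have h: "h \<in> strips f" "h \<noteq> f" using that by (auto simp: S_def)
      then obtain r where "h r \<noteq> f r" by blast
      then have r: "h r < f r" using stripsD(1)[OF h(1), of r] by simp
      then have "r < n" using less.prems(2)[of r] by (cases "r < n") auto
      with r stripsD(1)[OF h(1)] show "(\<Sum>r<n. h r) < (\<Sum>r<n. f r)"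
        by (intro sum_strict_mono_ex1) auto
      show "antimono h" "\<And>r. n \<le> r \<Longrightarrow> h r = 0"
        using antimono_strip[OF h(1)] strip_eq_0[OF h(1)] less.prems(2) by auto
    qed
    then obtain P :: "(nat \<Rightarrow> nat) \<Rightarrow> rat poly"
      where P: "\<And>h k. h \<in> S \<Longrightarrow> poly (P h) (of_nat k) = of_nat (card (gt_patterns k h))"
        "\<And>h. h \<in> S \<Longrightarrow> poly (P h) (- 1) = v h"
      by metis
    obtain p where p: "\<And>x. poly p (x + 1) = poly p x + poly (\<Sum>h\<in>S. P h) x" "poly p 0 = 0"
      using poly_antidifference[of "\<Sum>h\<in>S. P h" 0] by blast
    have "poly p (of_nat k) = of_nat (card (gt_patterns k f))" for k
    proof (induction k)
      case 0
      then show ?case using False p(2) by (auto simp: gt_patterns_0 fun_eq_iff)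
    next
      case (Suc k)
      have "of_nat (card (gt_patterns (Suc k) f))
          = (of_nat (card (gt_patterns k f)) + (\<Sum>h\<in>S. of_nat (card (gt_patterns k h))) :: rat)"
        unfolding card_Suc S_def
        using sum.remove[OF fin self, of "\<lambda>h. card (gt_patterns k h)"] by simp
      then show ?case
        using p(1)[of "of_nat k"] Suc P(1) by (simp add: poly_sum add.commute)
    qed
    moreover have "poly p (- 1) = v f"
    proof -
      have "v f + (\<Sum>h\<in>S. v h) = (\<Sum>h\<in>strips f. v h)"
        unfolding S_def using sum.remove[OF fin self, of v] by simp
      also have "\<dots> = 0"
        using sum_sign_column_strips[of n f] less.prems(2) False fin
        by (simp add: v_def sum.If_cases Int_def)
      finally show ?thesis
        using p(1)[of "- 1"] p(2) P(2) by (simp add: poly_sum eq_neg_iff_add_eq_0)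
    qed
    ultimately show ?thesis unfolding v_def by blast
  qed
qed

section \<open>Existence and uniqueness of Schur expansions\<close>

text \<open>The content of the superstandard tableau, that is, the monomial with exponent vector
  \<open>\<mu>\<close>. Rows are shifted by one because index 0 is not a variable.\<close>

definition row_content :: "nat list \<Rightarrow> nat multiset" where
  "row_content \<mu> = image_mset (\<lambda>(r, c). Suc r) (mset_set (cells \<mu>))"

lemma count_row_content_Suc: "count (row_content \<mu>) (Suc r) = row_length \<mu> r"
proof -
  have "{x \<in> cells \<mu>. (\<lambda>(r, c). Suc r) x = Suc r} = Pair r ` {..<row_length \<mu> r}"
    by (auto simp: mem_cells_iff)
  then show ?thesis
    by (simp add: row_content_def count_image_mset_set card_image inj_on_def)
qed

lemma zero_notin_row_content: "0 \<notin># row_content \<mu>"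
  by (auto simp: row_content_def)

lemma size_row_content: "size (row_content \<mu>) = sum_list \<mu>"
  by (simp add: row_content_def card_cells)

lemma row_content_inject:
  assumes "is_partition \<mu>" "is_partition \<nu>" "row_content \<mu> = row_content \<nu>"
  shows "\<mu> = \<nu>"
  using count_row_content_Suc[of \<mu>] count_row_content_Suc[of \<nu>] assms(3)
  by (intro partition_eqI[OF assms(1,2)] ext) metis

lemma sum_mset_image_mset_set: "sum_mset (image_mset f (mset_set A)) = sum f A"
  by (simp add: sum_unfold_sum_mset)

lemma tableau_gt_row:
  assumes \<mu>: "is_partition \<mu>" and T: "T \<in> semistandard_tableaux \<mu>"
    and c: "c < row_length \<mu> r"
  shows "Suc r \<le> T (r, c)"
  using c
proof (induction r)
  case 0
  then show ?case using tableauD(1)[OF T] by (simp add: mem_cells_iff)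
next
  case (Suc r)
  have "c < row_length \<mu> r"
    using antimonoD[OF antimono_row_length[OF \<mu>], of r "Suc r"] Suc.prems by simp
  then show ?case
    using Suc.IH tableauD(3)[OF T, of c r "Suc r"] Suc.prems by simp
qed

lemma schur_nonzeroE:
  assumes "schur \<mu> M \<noteq> 0"
  obtains T where "T \<in> semistandard_tableaux \<mu>" "M = image_mset T (mset_set (cells \<mu>))"
proof -
  have "{T \<in> semistandard_tableaux \<mu>. image_mset T (mset_set (cells \<mu>)) = M} \<noteq> {}"
    using assms unfolding schur_def by (metis card.empty of_nat_0)
  then show ?thesis using that by blast
qed

lemma schur_nonzero_size:
  assumes "schur \<mu> M \<noteq> 0"
  shows "size M = sum_list \<mu>" "0 \<notin># M"
proof -
  obtain T where T: "T \<in> semistandard_tableaux \<mu>" "M = image_mset T (mset_set (cells \<mu>))"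
    using assms by (rule schur_nonzeroE)
  show "size M = sum_list \<mu>" by (simp add: T(2) card_cells)
  show "0 \<notin># M" using tableauD(1)[OF T(1)] by (force simp: T(2))
qed

text \<open>
  In a tableau of shape \<open>\<nu>\<close>, row \<open>r\<close> has entries greater than \<open>r\<close>, so \<open>row_content \<nu>\<close> has the
  smallest sum among all contents, and it is attained only by the superstandard tableau.
\<close>

lemma schur_row_content_nonzero:
  assumes \<nu>: "is_partition \<nu>" and \<mu>: "is_partition \<mu>"
    and "schur \<nu> (row_content \<mu>) \<noteq> 0"
  shows "sum_mset (row_content \<nu>) < sum_mset (row_content \<mu>) \<or> \<nu> = \<mu>"
proof -
  obtain T where T: "T \<in> semistandard_tableaux \<nu>"
    and M: "row_content \<mu> = image_mset T (mset_set (cells \<nu>))"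
    using assms(3) by (rule schur_nonzeroE)
  have le: "(\<lambda>(r, c). Suc r) x \<le> T x" if "x \<in> cells \<nu>" for x
    using that tableau_gt_row[OF \<nu> T] by (cases x) (auto simp: mem_cells_iff)
  show ?thesis
  proof (cases "sum_mset (row_content \<nu>) = sum_mset (row_content \<mu>)")
    case True
    then have "(\<lambda>(r, c). Suc r) x = T x" if "x \<in> cells \<nu>" for x
      using that le unfolding M row_content_def[of \<nu>] sum_mset_image_mset_set
      by (intro sum_mono_inv[of _ "cells \<nu>" T]) auto
    then have "row_content \<nu> = row_content \<mu>"
      unfolding M row_content_def[of \<nu>] by (intro image_mset_cong) auto
    then show ?thesis using row_content_inject[OF \<nu> \<mu>] by simp
  next
    case False
    moreover have "sum_mset (row_content \<nu>) \<le> sum_mset (row_content \<mu>)"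
      unfolding M row_content_def[of \<nu>] sum_mset_image_mset_set by (intro sum_mono le)
    ultimately show ?thesis by simp
  qed
qed

text \<open>The diagonal Kostka number is 1: every entry of row \<open>r\<close> is at least
  \<open>r + 1\<close>, and equality of the sums forces equality in each cell.\<close>

lemma schur_row_content_self:
  assumes \<mu>: "is_partition \<mu>"
  shows "schur \<mu> (row_content \<mu>) = 1"
proof -
  let ?T = "restrict (\<lambda>(r, c). Suc r) (cells \<mu>)"
  have T: "?T \<in> semistandard_tableaux \<mu>"
    unfolding semistandard_tableaux_def by auto
  have cont: "image_mset ?T (mset_set (cells \<mu>)) = row_content \<mu>"
    unfolding row_content_def by (intro image_mset_cong) auto
  have "T' = ?T" if T': "T' \<in> semistandard_tableaux \<mu>"
    and M: "image_mset T' (mset_set (cells \<mu>)) = row_content \<mu>" for T'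
  proof
    fix x
    show "T' x = ?T x"
    proof (cases "x \<in> cells \<mu>")
      case True
      have "(\<lambda>(r, c). Suc r) y \<le> T' y" if "y \<in> cells \<mu>" for y
        using that tableau_gt_row[OF \<mu> T'] by (cases y) (auto simp: mem_cells_iff)
      moreover have "sum (\<lambda>(r, c). Suc r) (cells \<mu>) = sum T' (cells \<mu>)"
        using arg_cong[OF M, of sum_mset] unfolding row_content_def sum_mset_image_mset_set
        by simp
      ultimately have "(\<lambda>(r, c). Suc r) x = T' x"
        using True by (intro sum_mono_inv[of _ "cells \<mu>" T']) auto
      then show ?thesis using True by simp
    next
      case False
      then show ?thesis using tableauD(4)[OF T'] by simp
    qed
  qed
  then have "{T \<in> semistandard_tableaux \<mu>. image_mset T (mset_set (cells \<mu>)) = row_content \<mu>} = {?T}"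
    using T cont by blast
  then show ?thesis by (simp add: schur_def)
qed

text \<open>Enlarging the support to any finite set lets two expansions be compared over a common
  index set.\<close>

lemma schur_expansion_sum:
  assumes "schur_expansion F c" "finite U" "{\<mu>. c \<mu> \<noteq> 0} \<subseteq> U"
  shows "F M = (\<Sum>\<mu>\<in>U. c \<mu> * schur \<mu> M)"
proof -
  have "F M = (\<Sum>\<mu> | c \<mu> \<noteq> 0. c \<mu> * schur \<mu> M)"
    using assms(1) by (simp add: schur_expansion_def)
  also have "\<dots> = (\<Sum>\<mu>\<in>U. c \<mu> * schur \<mu> M)"
    using assms(2,3) by (intro sum.mono_neutral_left) auto
  finally show ?thesis .
qed

lemma schur_expansionI:
  assumes "finite U" "{\<mu>. c \<mu> \<noteq> 0} \<subseteq> U" "\<And>\<mu>. c \<mu> \<noteq> 0 \<Longrightarrow> is_partition \<mu>"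
    and "\<And>M. F M = (\<Sum>\<mu>\<in>U. c \<mu> * schur \<mu> M)"
  shows "schur_expansion F c"
proof -
  have "(\<Sum>\<mu> | c \<mu> \<noteq> 0. c \<mu> * schur \<mu> M) = (\<Sum>\<mu>\<in>U. c \<mu> * schur \<mu> M)" for M
    using assms(1,2) by (intro sum.mono_neutral_left) auto
  then show ?thesis
    unfolding schur_expansion_def using finite_subset[OF assms(2,1)] assms(3,4) by auto
qed

text \<open>Take a partition of least weight at which the coefficients differ and read off its own
  monomial. Partitions of smaller weight cancel, and among the others only the chosen one
  contributes, with factor 1.\<close>

lemma schur_expansion_unique:
  assumes c: "schur_expansion F c" and d: "schur_expansion F d"
  shows "c = d"
proof (rule ccontr)
  assume "c \<noteq> d"
  then obtain \<mu>0 where "c \<mu>0 \<noteq> d \<mu>0" by blast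
  then obtain \<mu> where \<mu>: "c \<mu> \<noteq> d \<mu>"
    and min: "\<And>\<nu>. c \<nu> \<noteq> d \<nu> \<Longrightarrow> sum_mset (row_content \<mu>) \<le> sum_mset (row_content \<nu>)"
    using ex_has_least_nat[of "\<lambda>\<mu>. c \<mu> \<noteq> d \<mu>" \<mu>0 "\<lambda>\<mu>. sum_mset (row_content \<mu>)"] by blast
  define U where "U = {\<mu>. c \<mu> \<noteq> 0} \<union> {\<mu>. d \<mu> \<noteq> 0}"
  have U: "finite U" "\<And>\<nu>. \<nu> \<in> U \<Longrightarrow> is_partition \<nu>"
    using c d by (auto simp: U_def schur_expansion_def)
  have "\<mu> \<in> U" using \<mu> by (auto simp: U_def)
  have "(c \<nu> - d \<nu>) * schur \<nu> (row_content \<mu>) = 0" if "\<nu> \<in> U - {\<mu>}" for \<nu>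
    using schur_row_content_nonzero[of \<nu> \<mu>] min[of \<nu>] U(2)[of \<nu>] U(2)[OF \<open>\<mu> \<in> U\<close>] that
    by fastforce
  then have "(\<Sum>\<nu>\<in>U - {\<mu>}. (c \<nu> - d \<nu>) * schur \<nu> (row_content \<mu>)) = 0"
    by (rule sum.neutral[OF ballI])
  then have "(\<Sum>\<nu>\<in>U. (c \<nu> - d \<nu>) * schur \<nu> (row_content \<mu>)) = c \<mu> - d \<mu>"
    using sum.remove[OF U(1) \<open>\<mu> \<in> U\<close>, of "\<lambda>\<nu>. (c \<nu> - d \<nu>) * schur \<nu> (row_content \<mu>)"]
      schur_row_content_self[OF U(2)[OF \<open>\<mu> \<in> U\<close>]] by simp
  moreover have "F (row_content \<mu>) = (\<Sum>\<nu>\<in>U. c \<nu> * schur \<nu> (row_content \<mu>))"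
    by (rule schur_expansion_sum[OF c U(1)]) (simp add: U_def)
  moreover have "F (row_content \<mu>) = (\<Sum>\<nu>\<in>U. d \<nu> * schur \<nu> (row_content \<mu>))"
    by (rule schur_expansion_sum[OF d U(1)]) (simp add: U_def)
  ultimately show False
    using \<mu> by (simp add: left_diff_distrib sum_subtractf)
qed

lemma schur_coeff_eq: "schur_expansion F c \<Longrightarrow> schur_coeff \<mu> F = c \<mu>"
  unfolding schur_coeff_def using the_equality[of "schur_expansion F" c] schur_expansion_unique
  by metis

text \<open>Unknowns are added by increasing weight: a new one does not enter the equations already
  solved, because an off-diagonal entry needs a strict increase of weight, and its own equation
  fixes it.\<close>

lemma triangular_system_solvable:
  fixes K :: "'b \<Rightarrow> 'b \<Rightarrow> rat" and w :: "'b \<Rightarrow> nat"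
  assumes "finite P" "\<And>p. p \<in> P \<Longrightarrow> K p p = 1"
    and "\<And>p q. p \<in> P \<Longrightarrow> q \<in> P \<Longrightarrow> K p q \<noteq> 0 \<Longrightarrow> w p < w q \<or> p = q"
  shows "\<exists>c. \<forall>q\<in>P. f q = (\<Sum>p\<in>P. c p * K p q)"
  using assms
proof (induction P rule: finite_ranking_induct[where f = w])
  case (insert x S)
  show ?case
  proof (cases "x \<in> S")
    case True
    then show ?thesis using insert.IH insert.prems by (simp add: insert_absorb)
  next
    case False
    obtain c where c: "\<And>q. q \<in> S \<Longrightarrow> f q = (\<Sum>p\<in>S. c p * K p q)"
      using insert.IH insert.prems by auto
    define c' where "c' = c(x := f x - (\<Sum>p\<in>S. c p * K p x))"
    have S: "(\<Sum>p\<in>S. c' p * K p q) = (\<Sum>p\<in>S. c p * K p q)" for q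
      using False by (intro sum.cong) (auto simp: c'_def)
    have "f q = (\<Sum>p\<in>insert x S. c' p * K p q)" if q: "q \<in> insert x S" for q
    proof (cases "q = x")
      case True
      then show ?thesis
        using insert.hyps(1) False insert.prems(1)[of x] S by (simp add: c'_def)
    next
      case qx: False
      then have "K x q = 0"
        using q insert.prems(2)[of x q] insert.hyps(2)[of q] by auto
      then show ?thesis
        using qx q c[of q] S insert.hyps(1) False by simp
    qed
    then show ?thesis by blast
  qed
qed simp

section \<open>Reduction of symmetric series to partition contents\<close>

lemma sum_mset_swap:
  "sum_mset (image_mset (swap_adjacent m) M) + count M (Suc (Suc m))
   = sum_mset M + count M (Suc m)"
  by (induction M) (auto simp: transpose_def)

lemma antimono_count_eq_row_content:
  assumes anti: "\<And>m. count M (Suc (Suc m)) \<le> count M (Suc m)" and "0 \<notin># M"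
  obtains \<mu> where "is_partition \<mu>" "M = row_content \<mu>"
proof -
  define f where "f m = count M (Suc m)" for m
  have f: "antimono f"
    using anti by (simp add: antimono_iff_le_Suc f_def)
  define l where "l = (LEAST m. f m = 0)"
  have "f (Max (insert 0 (set_mset M))) = 0"
    unfolding f_def by (metis Max_ge Suc_n_not_le_n count_eq_zero_iff finite_insert
        finite_set_mset insert_iff)
  then have "f l = 0"
    unfolding l_def by (rule LeastI)
  then have ge: "f m = 0" if "l \<le> m" for m
    using antimonoD[OF f that] by simp
  have lt: "f m \<noteq> 0" if "m < l" for m
    using not_less_Least[of m "\<lambda>m. f m = 0"] that unfolding l_def by simp
  define \<mu> where "\<mu> = map f [0..<l]"
  have row: "row_length \<mu> = f"
    using ge by (auto simp: row_length_def \<mu>_def fun_eq_iff)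
  have "0 \<notin> set \<mu>"
    using lt by (force simp: \<mu>_def)
  then have "is_partition \<mu>"
    unfolding is_partition_def using antimonoD[OF f]
    by (auto simp: \<mu>_def sorted_wrt_iff_nth_less)
  moreover have "M = row_content \<mu>"
  proof (rule multiset_eqI)
    fix x
    show "count M x = count (row_content \<mu>) x"
      using \<open>0 \<notin># M\<close> zero_notin_row_content[of \<mu>]
      by (cases x) (simp_all add: count_row_content_Suc row f_def not_in_iff)
  qed
  ultimately show ?thesis by (rule that)
qed

text \<open>Sorting of exponents: a monomial whose exponents are not weakly decreasing has an
  adjacent ascent, and exchanging it lowers the sum of the indices, so the process ends at some
  \<open>row_content \<mu>\<close>.\<close>

lemma swap_invariant_eq_0:
  fixes H :: series
  assumes inv: "\<And>m M. H (image_mset (swap_adjacent m) M) = H M"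
    and part: "\<And>\<mu>. is_partition \<mu> \<Longrightarrow> H (row_content \<mu>) = 0"
    and zero: "\<And>M. 0 \<in># M \<Longrightarrow> H M = 0"
  shows "H M = 0"
proof (induction "sum_mset M" arbitrary: M rule: less_induct)
  case less
  show ?case
  proof (cases "\<exists>m. count M (Suc m) < count M (Suc (Suc m))")
    case True
    then obtain m where "count M (Suc m) < count M (Suc (Suc m))" ..
    then have "sum_mset (image_mset (swap_adjacent m) M) < sum_mset M"
      using sum_mset_swap[of m M] by linarith
    then show ?thesis using less inv by metis
  next
    case False
    then show ?thesis
      using antimono_count_eq_row_content[of M] part zero by (metis not_le)
  qed
qed

lemma length_le_sum_list: "is_partition \<mu> \<Longrightarrow> length \<mu> \<le> sum_list \<mu>"
  unfolding is_partition_def by (induction \<mu>) auto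

lemma finite_partitions: "finite {\<mu>. is_partition \<mu> \<and> sum_list \<mu> = n}"
proof (rule finite_subset)
  show "{\<mu>. is_partition \<mu> \<and> sum_list \<mu> = n} \<subseteq> {\<mu>. set \<mu> \<subseteq> {..n} \<and> length \<mu> \<le> n}"
    using member_le_sum_list length_le_sum_list by auto
qed (rule finite_lists_length_le[OF finite_atMost])

text \<open>The triangular system matches \<open>F\<close> on the monomials
  \<open>row_content \<mu>\<close>; the difference of both sides is symmetric and vanishes there,
  hence everywhere. Here the Bender--Knuth symmetry is used.\<close>

lemma schur_expansion_exists:
  assumes inv: "\<And>m M. F (image_mset (swap_adjacent m) M) = F M"
    and hom: "\<And>M. F M \<noteq> 0 \<Longrightarrow> size M = n \<and> 0 \<notin># M"
  obtains c where "schur_expansion F c" "\<And>\<mu>. c \<mu> \<noteq> 0 \<Longrightarrow> sum_list \<mu> = n"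
proof -
  define P where "P = {\<mu>. is_partition \<mu> \<and> sum_list \<mu> = n}"
  have "finite P" by (simp add: P_def finite_partitions)
  obtain c0 where c0: "\<And>\<mu>. \<mu> \<in> P \<Longrightarrow>
      F (row_content \<mu>) = (\<Sum>\<nu>\<in>P. c0 \<nu> * schur \<nu> (row_content \<mu>))"
    using triangular_system_solvable[of P "\<lambda>\<nu> \<mu>. schur \<nu> (row_content \<mu>)"
        "\<lambda>\<mu>. sum_mset (row_content \<mu>)" "\<lambda>\<mu>. F (row_content \<mu>)"]
      \<open>finite P\<close> schur_row_content_self schur_row_content_nonzero
    unfolding P_def by blast
  define H where "H M = F M - (\<Sum>\<nu>\<in>P. c0 \<nu> * schur \<nu> M)" for M
  have F0: "F M = 0" and S0: "(\<Sum>\<nu>\<in>P. c0 \<nu> * schur \<nu> M) = 0"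
    if "size M \<noteq> n \<or> 0 \<in># M" for M
  proof -
    show "F M = 0" using hom that by blast
    show "(\<Sum>\<nu>\<in>P. c0 \<nu> * schur \<nu> M) = 0"
      using that schur_nonzero_size[of _ M] by (intro sum.neutral ballI) (auto simp: P_def)
  qed
  have "H M = 0" for M
  proof (rule swap_invariant_eq_0)
    show "H (image_mset (swap_adjacent m) M) = H M" for m M
      unfolding H_def inv by (auto simp: schur_swap P_def intro!: sum.cong)
    show "H (row_content \<mu>) = 0" if "is_partition \<mu>" for \<mu>
    proof (cases "\<mu> \<in> P")
      case True
      then show ?thesis by (simp add: H_def c0)
    next
      case False
      then have "size (row_content \<mu>) \<noteq> n"
        using that by (simp add: P_def size_row_content)
      then show ?thesis by (simp add: H_def F0 S0)
    qed
    show "H M = 0" if "0 \<in># M" for M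
      using that by (simp add: H_def F0 S0)
  qed
  then have F: "F M = (\<Sum>\<nu>\<in>P. c0 \<nu> * schur \<nu> M)" for M
    by (simp add: H_def)
  show ?thesis
  proof (rule that)
    show "schur_expansion F (\<lambda>\<mu>. if \<mu> \<in> P then c0 \<mu> else 0)"
      by (rule schur_expansionI[OF \<open>finite P\<close>]) (auto simp: F P_def split: if_splits)
  qed (auto simp: P_def split: if_splits)
qed

section \<open>Colorings of trees\<close>

text \<open>Proper colorings of the subgraph induced on \<open>S\<close>, so that a tree can be
  colored while it is grown vertex by vertex.\<close>

definition partial_colorings :: "'a pair_pre_digraph \<Rightarrow> 'a set \<Rightarrow> nat \<Rightarrow> ('a \<Rightarrow> nat) set" where
  "partial_colorings G S k =
     {\<kappa> \<in> S \<rightarrow>\<^sub>E {1..k}. \<forall>(u, v) \<in> parcs G. u \<in> S \<and> v \<in> S \<longrightarrow> \<kappa> u \<noteq> \<kappa> v}"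

lemma finite_partial_colorings: "finite S \<Longrightarrow> finite (partial_colorings G S k)"
  unfolding partial_colorings_def by (intro finite_subset[OF _ finite_PiE[of S "\<lambda>_. {1..k}"]]) auto

text \<open>The new vertex is a leaf at \<open>u\<close> and avoids just the color of
  \<open>u\<close>. The truncated \<open>k - 1\<close> is harmless at \<open>k = 0\<close>, where
  the nonempty \<open>S\<close> has no coloring.\<close>

lemma card_partial_colorings_insert:
  assumes G: "pair_graph G" and S: "finite S" and v: "v \<notin> S" and u: "u \<in> S"
    and nbr: "\<And>w. w \<in> S \<Longrightarrow> (w, v) \<in> parcs G \<longleftrightarrow> w = u"
  shows "card (partial_colorings G (insert v S) k) = card (partial_colorings G S k) * (k - 1)"
proof -
  interpret pair_graph G by fact
  have sym: "(w, v) \<in> parcs G" if "(v, w) \<in> parcs G" for w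
    using that arcs_symmetric by blast
  have noloop: "(v, v) \<notin> parcs G"
    using pair_no_loops[of "(v, v)"] by auto
  have adj: "(\<forall>(x, y) \<in> parcs G. x \<in> insert v S \<and> y \<in> insert v S \<longrightarrow> \<kappa> x \<noteq> \<kappa> y) \<longleftrightarrow>
      (\<forall>(x, y) \<in> parcs G. x \<in> S \<and> y \<in> S \<longrightarrow> \<kappa> x \<noteq> \<kappa> y) \<and> \<kappa> v \<noteq> \<kappa> u" for \<kappa> :: "'a \<Rightarrow> nat"
    using nbr[OF u] nbr sym noloop u by fastforce
  let ?Sig = "Sigma (partial_colorings G S k) (\<lambda>\<kappa>. {1..k} - {\<kappa> u})"
  have "bij_betw (\<lambda>\<kappa>. (restrict \<kappa> S, \<kappa> v)) (partial_colorings G (insert v S) k) ?Sig"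
  proof (rule bij_betw_byWitness[where f' = "\<lambda>(\<kappa>, c). \<kappa>(v := c)"])
    show "\<forall>\<kappa>\<in>partial_colorings G (insert v S) k.
        (\<lambda>(\<kappa>, c). \<kappa>(v := c)) (restrict \<kappa> S, \<kappa> v) = \<kappa>"
      by (auto simp: partial_colorings_def fun_eq_iff PiE_iff extensional_def)
    show "\<forall>x\<in>?Sig. (restrict ((\<lambda>(\<kappa>, c). \<kappa>(v := c)) x) S, ((\<lambda>(\<kappa>, c). \<kappa>(v := c)) x) v) = x"
      using v by (auto simp: partial_colorings_def fun_eq_iff PiE_iff extensional_def)
    show "(\<lambda>\<kappa>. (restrict \<kappa> S, \<kappa> v)) ` partial_colorings G (insert v S) k \<subseteq> ?Sig"
    proof safe
      fix \<kappa> assume \<kappa>: "\<kappa> \<in> partial_colorings G (insert v S) k"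
      then show "restrict \<kappa> S \<in> partial_colorings G S k" "\<kappa> v \<in> {1..k}"
        by (auto simp: partial_colorings_def PiE_iff)
      assume "\<kappa> v = restrict \<kappa> S u"
      then show False
        using \<kappa> u unfolding partial_colorings_def adj by simp
    qed
    show "(\<lambda>(\<kappa>, c). \<kappa>(v := c)) ` ?Sig \<subseteq> partial_colorings G (insert v S) k"
    proof
      fix \<kappa>' assume "\<kappa>' \<in> (\<lambda>(\<kappa>, c). \<kappa>(v := c)) ` ?Sig"
      then obtain x where "x \<in> ?Sig" and "\<kappa>' = (\<lambda>(\<kappa>, c). \<kappa>(v := c)) x" by blast
      moreover obtain \<kappa> c where "x = (\<kappa>, c)" by force
      ultimately have \<kappa>: "\<kappa> \<in> partial_colorings G S k" and c: "c \<in> {1..k}" "c \<noteq> \<kappa> u"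
        and \<kappa>': "\<kappa>' = \<kappa>(v := c)" by simp_all
      have "\<forall>(x, y) \<in> parcs G. x \<in> S \<and> y \<in> S \<longrightarrow> (\<kappa>(v := c)) x \<noteq> (\<kappa>(v := c)) y"
      proof clarify
        fix x y assume "(x, y) \<in> parcs G" "x \<in> S" "y \<in> S" "(\<kappa>(v := c)) x = (\<kappa>(v := c)) y"
        moreover from this have "x \<noteq> v" "y \<noteq> v" using v by auto
        ultimately show False using \<kappa> by (auto simp: partial_colorings_def)
      qed
      then show "\<kappa>' \<in> partial_colorings G (insert v S) k"
        using \<kappa> c u v unfolding \<kappa>' partial_colorings_def adj by (auto simp: PiE_iff extensional_def)
    qed
  qed
  then have "card (partial_colorings G (insert v S) k) = card ?Sig"
    by (rule bij_betw_same_card)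
  also have "\<dots> = (\<Sum>\<kappa>\<in>partial_colorings G S k. card ({1..k} - {\<kappa> u}))"
    using S by (simp add: finite_partial_colorings)
  also have "\<dots> = (\<Sum>\<kappa>\<in>partial_colorings G S k. k - 1)"
    using u by (intro sum.cong) (auto simp: partial_colorings_def PiE_iff)
  finally show ?thesis by simp
qed

text \<open>A path inside \<open>S\<close> between two neighbours of \<open>v\<close> closes up
  through \<open>v\<close>. It has at least one arc since \<open>u \<noteq> w\<close>, so with the
  two arcs at \<open>v\<close> the cycle is not the degenerate back-and-forth along an edge.\<close>

lemma cycle_through_new_vertex:
  assumes G: "pair_graph G" and S: "S \<subseteq> pverts G"
    and conn: "(u, w) \<in> (parcs G \<inter> S \<times> S)\<^sup>*" and u: "u \<in> S" and "u \<noteq> w"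
    and v: "v \<notin> S" "(u, v) \<in> parcs G" "(w, v) \<in> parcs G"
  shows "\<exists>p. pre_digraph.cycle (with_proj G) p \<and> 3 \<le> length p"
proof -
  interpret pair_graph G by fact
  \<comment> \<open>Taking the simple path in the induced subgraph keeps it away from
    \<open>v\<close>, so the closed walk visits \<open>v\<close> only once.\<close>
  define H where "H = \<lparr>pverts = S, parcs = parcs G \<inter> S \<times> S\<rparr>"
  interpret H: pair_wf_digraph H by unfold_locales (auto simp: H_def)
  have "u \<rightarrow>\<^sup>*\<^bsub>with_proj H\<^esub> w"
    using conn
  proof (induction rule: rtrancl_induct)
    case base
    show ?case unfolding reachable_def using u by (intro rtrancl_on_refl) (simp add: H_def)
  next
    case (step x y)
    then have "(x, y) \<in> parcs H" by (simp add: H_def)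
    with step.IH show ?case using H.reachable_adj_trans by auto
  qed
  then obtain p where p: "H.apath u p w"
    using H.reachable_apath by blast
  then have cas: "pcas u p w" and "set p \<subseteq> parcs H" and dist: "distinct (pawalk_verts u p)"
    by (auto simp: H.apath_def H.awalk_def)
  then have arcs: "set p \<subseteq> parcs G \<inter> S \<times> S"
    by (simp add: H_def)
  have "p \<noteq> []" using cas \<open>u \<noteq> w\<close> by auto
  have snd_last: "snd (last p) = w"
    using cas \<open>p \<noteq> []\<close> by (induction u p w rule: pcas.induct) auto
  let ?c = "(v, u) # p @ [(w, v)]"
  have verts: "pawalk_verts u p = map fst p @ [w]"
    using \<open>p \<noteq> []\<close> snd_last by (simp add: awalk_verts_conv)
  have in_S: "set (pawalk_verts u p) \<subseteq> S"
    using arcs snd_last last_in_set[OF \<open>p \<noteq> []\<close>] unfolding verts by auto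
  have vu: "(v, u) \<in> parcs G" "v \<in> pverts G"
    using v arcs_symmetric in_arcsD2 by blast+
  have "awlast u p = w" using verts by simp
  then have "awalk v ?c v"
    using cas arcs v vu by (auto simp: awalk_def)
  moreover have "pawalk_verts u (p @ [(w, v)]) = pawalk_verts u p @ [v]"
    using \<open>p \<noteq> []\<close> snd_last by (simp add: awalk_verts_conv)
  then have "distinct (tl (pawalk_verts v ?c))"
    using dist in_S v(1) by auto
  ultimately have "cycle ?c"
    unfolding cycle_def by blast
  moreover have "3 \<le> length ?c" using \<open>p \<noteq> []\<close> by (cases p) auto
  ultimately show ?thesis by blast
qed

lemma connected_escape:
  assumes G: "G \<in> connected_graphs n" and S: "S \<subset> pverts G" "S \<noteq> {}"
  obtains u v where "u \<in> S" "v \<in> pverts G" "v \<notin> S" "(u, v) \<in> parcs G"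
proof -
  interpret pair_graph G using G by (simp add: connected_graphs_def)
  obtain a b where a: "a \<in> S" and b: "b \<in> pverts G" "b \<notin> S"
    using S by blast
  \<comment> \<open>Connectedness is defined through the symmetric closure, which adds no arcs
    here.\<close>
  have mk: "parcs (mk_symmetric (with_proj G)) = parcs G"
    using arcs_symmetric by (auto simp: mk_symmetric_def)
  have "strongly_connected (with_proj (mk_symmetric (with_proj G)))"
    using G by (simp add: connected_graphs_def Digraph_Component.connected_def)
  then have "(a, b) \<in> rtrancl_on (pverts G) (parcs G)"
    using a b S by (auto simp: strongly_connected_def reachable_def mk)
  then have "b \<in> S" if "\<forall>(u, v) \<in> parcs G. u \<in> S \<longrightarrow> v \<in> S"
  proof (induction rule: rtrancl_on_induct)
    case base
    then show ?case using a by simp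
  next
    case (step x y)
    then show ?case using that by blast
  qed
  then obtain u v where "(u, v) \<in> parcs G" "u \<in> S" "v \<notin> S"
    using b by blast
  then show ?thesis
    using that in_arcsD2 by blast
qed

text \<open>Connectedness supplies an edge leaving the current vertex set, and acyclicity makes its
  far end a leaf of the enlarged set, so each new vertex contributes a factor
  \<open>k - 1\<close>.\<close>

lemma card_partial_colorings_tree:
  assumes T: "G \<in> trees n"
  shows "card (partial_colorings G (pverts G) k) = k * (k - 1) ^ (n - 1)"
proof -
  have conn: "G \<in> connected_graphs n"
    and acyclic: "\<not> (\<exists>p. pre_digraph.cycle (with_proj G) p \<and> 3 \<le> length p)"
    using T by (auto simp: trees_def)
  then have G: "pair_graph G" and n: "card (pverts G) = n"
    and sc: "strongly_connected (with_proj (mk_symmetric (with_proj G)))"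
    by (auto simp: connected_graphs_def Digraph_Component.connected_def)
  interpret pair_graph G by fact
  have "pverts G \<noteq> {}"
    using sc by (auto simp: strongly_connected_def mk_symmetric_def)
  then have "1 \<le> n"
    using n pair_finite_verts by (auto simp: Suc_le_eq card_gt_0_iff)
  \<comment> \<open>Connectedness of \<open>S\<close> within itself is carried along because
    excluding a second neighbour of the new vertex takes a path that stays in
    \<open>S\<close>.\<close>
  have "\<exists>S \<subseteq> pverts G. card S = m \<and> S \<times> S \<subseteq> (parcs G \<inter> S \<times> S)\<^sup>* \<and>
      card (partial_colorings G S k) = k * (k - 1) ^ (m - 1)" if "1 \<le> m" "m \<le> n" for m
    using that
  proof (induction m rule: dec_induct)
    case base
    obtain r where r: "r \<in> pverts G" using \<open>pverts G \<noteq> {}\<close> by blast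
    have "(r, r) \<notin> parcs G" using pair_no_loops[of "(r, r)"] by auto
    then have "partial_colorings G {r} k = {r} \<rightarrow>\<^sub>E {1..k}"
      by (auto simp: partial_colorings_def)
    then show ?case
      using r by (intro exI[of _ "{r}"]) (simp add: card_PiE)
  next
    case (step m)
    then obtain S where S: "S \<subseteq> pverts G" "card S = m" "S \<times> S \<subseteq> (parcs G \<inter> S \<times> S)\<^sup>*"
      and col: "card (partial_colorings G S k) = k * (k - 1) ^ (m - 1)"
      by auto
    have fin: "finite S" using S(1) pair_finite_verts finite_subset by blast
    have "S \<subset> pverts G" "S \<noteq> {}" using S step.hyps step.prems n by auto
    then obtain u v where uv: "u \<in> S" "v \<in> pverts G" "v \<notin> S" "(u, v) \<in> parcs G"
      using connected_escape[OF conn] by metis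
    have nbr: "(w, v) \<in> parcs G \<longleftrightarrow> w = u" if "w \<in> S" for w
      using cycle_through_new_vertex[OF G S(1), of u w v] S(3) uv that acyclic by blast
    let ?S = "insert v S"
    let ?R = "(parcs G \<inter> ?S \<times> ?S)\<^sup>*"
    have vu: "(v, u) \<in> parcs G" using uv arcs_symmetric by blast
    have R: "(a, b) \<in> ?R" if "a \<in> S" "b \<in> S" for a b
      using S(3) that rtrancl_mono[of "parcs G \<inter> S \<times> S" "parcs G \<inter> ?S \<times> ?S"] by blast
    have "(a, v) \<in> ?R" "(v, a) \<in> ?R" if "a \<in> S" for a
      using R[OF that uv(1)] R[OF uv(1) that] uv vu
      by (auto intro: rtrancl_into_rtrancl converse_rtrancl_into_rtrancl)
    then have "?S \<times> ?S \<subseteq> ?R" using R by auto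
    moreover have "card (partial_colorings G ?S k) = k * (k - 1) ^ (Suc m - 1)"
      using card_partial_colorings_insert[OF G fin uv(3,1) nbr] col step.hyps
      by (cases m) (simp_all add: mult.assoc mult.commute)
    ultimately show ?case
      using S uv fin by (intro exI[of _ ?S]) simp
  qed
  from this[of n] obtain S where "S \<subseteq> pverts G" "card S = n"
    and col: "card (partial_colorings G S k) = k * (k - 1) ^ (n - 1)"
    using \<open>1 \<le> n\<close> by auto
  then have "S = pverts G"
    using n pair_finite_verts by (simp add: card_subset_eq)
  then show ?thesis using col by simp
qed

section \<open>Trees form an antichain\<close>

lemma card_fibers:
  assumes "finite S" "finite B" "\<And>x. x \<in> S \<Longrightarrow> h x \<in> B"
  shows "(\<Sum>M\<in>B. card {x \<in> S. h x = M}) = card S"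
proof -
  have "card S = card (\<Union>M\<in>B. {x \<in> S. h x = M})"
    using assms(3) by (intro arg_cong[of _ _ card]) auto
  also have "\<dots> = (\<Sum>M\<in>B. card {x \<in> S. h x = M})"
    using assms(1,2) by (intro card_UN_disjoint) auto
  finally show ?thesis ..
qed

text \<open>Series are coefficient functions, so setting the first \<open>k\<close> variables to 1
  and the others to 0 means adding up the coefficients of all degree \<open>n\<close> monomials in
  the first \<open>k\<close> variables.\<close>

lemma sum_schur:
  assumes "sum_list \<mu> = n"
  shows "(\<Sum>M\<in>multisets_of_size {1..k} n. schur \<mu> M) = of_nat (card (bounded_tableaux k \<mu>))"
proof -
  let ?c = "\<lambda>T. image_mset T (mset_set (cells \<mu>))"
  have "schur \<mu> M = of_nat (card {T \<in> bounded_tableaux k \<mu>. ?c T = M})"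
    if "M \<in> multisets_of_size {1..k} n" for M
  proof -
    have "{T \<in> semistandard_tableaux \<mu>. ?c T = M} = {T \<in> bounded_tableaux k \<mu>. ?c T = M}"
      using that by (fastforce simp: bounded_tableaux_def multisets_of_size_def)
    then show ?thesis by (simp add: schur_def)
  qed
  moreover have "?c T \<in> multisets_of_size {1..k} n" if "T \<in> bounded_tableaux k \<mu>" for T
    using that tableauD(1)[of T \<mu>] assms
    by (fastforce simp: bounded_tableaux_def multisets_of_size_def card_cells)
  ultimately show ?thesis
    using card_fibers[of "bounded_tableaux k \<mu>" "multisets_of_size {1..k} n" ?c]
    by (simp flip: of_nat_sum add: finite_multisets_of_size)
qed

lemma sum_schur_expansion:
  assumes "schur_expansion F c" "finite U" "{\<mu>. c \<mu> \<noteq> 0} \<subseteq> U" "\<And>\<mu>. \<mu> \<in> U \<Longrightarrow> sum_list \<mu> = n"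
  shows "(\<Sum>M\<in>multisets_of_size {1..k} n. F M)
    = (\<Sum>\<mu>\<in>U. c \<mu> * of_nat (card (bounded_tableaux k \<mu>)))"
  unfolding schur_expansion_sum[OF assms(1-3)]
  by (subst sum.swap, rule sum.cong) (simp_all only: assms(4) sum_schur flip: sum_distrib_left)

lemma sum_chromatic_symmetric_function:
  assumes G: "pair_graph G" and n: "card (pverts G) = n"
  shows "(\<Sum>M\<in>multisets_of_size {1..k} n. chromatic_symmetric_function G M)
    = of_nat (card (partial_colorings G (pverts G) k))"
proof -
  interpret pair_graph G by fact
  let ?c = "\<lambda>\<kappa>. image_mset \<kappa> (mset_set (pverts G))"
  have "chromatic_symmetric_function G M
      = of_nat (card {\<kappa> \<in> partial_colorings G (pverts G) k. ?c \<kappa> = M})"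
    if "M \<in> multisets_of_size {1..k} n" for M
  proof -
    have "\<kappa> \<in> proper_colorings G \<longleftrightarrow> \<kappa> \<in> partial_colorings G (pverts G) k" if "?c \<kappa> = M" for \<kappa>
    proof -
      have "\<kappa> ` pverts G \<subseteq> {1..k}"
        using \<open>M \<in> multisets_of_size {1..k} n\<close> that pair_finite_verts
        by (auto simp: multisets_of_size_def)
      then show ?thesis
        using in_arcsD1 in_arcsD2
        by (fastforce simp: proper_colorings_def partial_colorings_def PiE_iff)
    qed
    then have "{\<kappa> \<in> proper_colorings G. ?c \<kappa> = M}
        = {\<kappa> \<in> partial_colorings G (pverts G) k. ?c \<kappa> = M}" by blast
    then show ?thesis by (simp add: chromatic_symmetric_function_def)
  qed
  moreover have "?c \<kappa> \<in> multisets_of_size {1..k} n"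
    if "\<kappa> \<in> partial_colorings G (pverts G) k" for \<kappa>
    using that pair_finite_verts n by (auto simp: partial_colorings_def multisets_of_size_def)
  ultimately show ?thesis
    using card_fibers[of "partial_colorings G (pverts G) k" "multisets_of_size {1..k} n" ?c]
    by (simp flip: of_nat_sum
        add: finite_multisets_of_size finite_partial_colorings pair_finite_verts)
qed

section \<open>Schur expansion of the chromatic symmetric function\<close>

lemma chromatic_symmetric_function_swap:
  assumes "finite (pverts G)" and wf: "\<And>u v. (u, v) \<in> parcs G \<Longrightarrow> u \<in> pverts G \<and> v \<in> pverts G"
  shows "chromatic_symmetric_function G (image_mset (swap_adjacent m) M)
    = chromatic_symmetric_function G M"
proof -
  let ?A = "\<lambda>M. {\<kappa> \<in> proper_colorings G. image_mset \<kappa> (mset_set (pverts G)) = M}"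
  let ?f = "\<lambda>\<kappa>. restrict (swap_adjacent m \<circ> \<kappa>) (pverts G)"
  have ff: "?f (?f \<kappa>) = \<kappa>" if "\<kappa> \<in> ?A N" for \<kappa> N
    using that by (auto simp: proper_colorings_def fun_eq_iff PiE_iff extensional_def)
  have sub: "?f ` ?A N \<subseteq> ?A (image_mset (swap_adjacent m) N)" for N
  proof
    fix \<kappa>' assume "\<kappa>' \<in> ?f ` ?A N"
    then obtain \<kappa> where \<kappa>: "\<kappa> \<in> proper_colorings G" "image_mset \<kappa> (mset_set (pverts G)) = N"
      and \<kappa>': "\<kappa>' = ?f \<kappa>" by auto
    have "image_mset \<kappa>' (mset_set (pverts G))
        = image_mset (swap_adjacent m \<circ> \<kappa>) (mset_set (pverts G))"
      unfolding \<kappa>' using assms(1) by (intro image_mset_cong) auto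
    also have "\<dots> = image_mset (swap_adjacent m) N"
      by (simp add: \<kappa>(2)[symmetric] image_mset.compositionality)
    finally have "image_mset \<kappa>' (mset_set (pverts G)) = image_mset (swap_adjacent m) N" .
    moreover have "\<kappa>' \<in> pverts G \<rightarrow>\<^sub>E {1..}"
    proof -
      have "1 \<le> swap_adjacent m x" if "1 \<le> x" for x
        using that by (simp add: transpose_def)
      then show ?thesis
        using \<kappa>(1) unfolding \<kappa>' by (auto simp: proper_colorings_def PiE_iff)
    qed
    moreover have "\<kappa>' u \<noteq> \<kappa>' v" if "(u, v) \<in> parcs G" for u v
    proof -
      have "\<kappa> u \<noteq> \<kappa> v" using \<kappa>(1) that by (auto simp: proper_colorings_def)
      then have "swap_adjacent m (\<kappa> u) \<noteq> swap_adjacent m (\<kappa> v)"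
        by (metis transpose_involutory)
      then show ?thesis using wf[OF that] by (simp add: \<kappa>')
    qed
    ultimately show "\<kappa>' \<in> ?A (image_mset (swap_adjacent m) N)"
      by (auto simp: proper_colorings_def)
  qed
  have "bij_betw ?f (?A M) (?A (image_mset (swap_adjacent m) M))"
  proof (rule bij_betw_byWitness[where f' = ?f])
    show "?f ` ?A (image_mset (swap_adjacent m) M) \<subseteq> ?A M"
      using sub[of "image_mset (swap_adjacent m) M"] by simp
  qed (use sub[of M] ff in blast)+
  then show ?thesis
    unfolding chromatic_symmetric_function_def by (simp add: bij_betw_same_card)
qed

lemma chromatic_symmetric_function_nonzero:
  assumes "chromatic_symmetric_function G M \<noteq> 0" "finite (pverts G)"
  shows "size M = card (pverts G) \<and> 0 \<notin># M"
proof -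
  have "{\<kappa> \<in> proper_colorings G. image_mset \<kappa> (mset_set (pverts G)) = M} \<noteq> {}"
    using assms(1) unfolding chromatic_symmetric_function_def by (metis card.empty of_nat_0)
  then show ?thesis
    using assms(2) by (force simp: proper_colorings_def)
qed

lemma chromatic_symmetric_function_expansion:
  assumes "G \<in> connected_graphs n"
  obtains c where "schur_expansion (chromatic_symmetric_function G) c"
    "\<And>\<mu>. c \<mu> \<noteq> 0 \<Longrightarrow> sum_list \<mu> = n"
proof -
  interpret pair_graph G using assms by (simp add: connected_graphs_def)
  have n: "card (pverts G) = n" using assms by (simp add: connected_graphs_def)
  show ?thesis
    using schur_expansion_exists[of "chromatic_symmetric_function G" n]
      chromatic_symmetric_function_swap[of G] chromatic_symmetric_function_nonzero[of G]
      pair_finite_verts in_arcsD1 in_arcsD2 n that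
    by metis
qed

section \<open>The coefficient of the single column\<close>

lemma partition_first_row_le_1:
  assumes "is_partition \<mu>"
  shows "row_length \<mu> 0 \<le> 1 \<longleftrightarrow> \<mu> = replicate (sum_list \<mu>) 1"
proof
  assume le: "row_length \<mu> 0 \<le> 1"
  have "x = 1" if x: "x \<in> set \<mu>" for x
  proof -
    obtain r where r: "r < length \<mu>" "x = \<mu> ! r" using x by (auto simp: in_set_conv_nth)
    then show ?thesis
      using antimonoD[OF antimono_row_length[OF assms], of 0 r] row_length_pos_iff[OF assms, of r] le
      by (simp add: row_length_def)
  qed
  then have eq: "replicate (length \<mu>) 1 = \<mu>"
    by (intro replicate_length_same) simp
  moreover have "sum_list (replicate (length \<mu>) 1) = length \<mu>"
    by (simp add: sum_list_replicate)
  ultimately show "\<mu> = replicate (sum_list \<mu>) 1"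
    by (simp only:)
next
  assume eq: "\<mu> = replicate (sum_list \<mu>) 1"
  have "row_length (replicate i 1) 0 \<le> 1" for i
    by (cases i) (simp_all add: row_length_def)
  moreover have "row_length \<mu> 0 = row_length (replicate (sum_list \<mu>) 1) 0"
    by (rule arg_cong[OF eq, of "\<lambda>\<mu>. row_length \<mu> 0"])
  ultimately show "row_length \<mu> 0 \<le> 1"
    by (simp only:)
qed

lemma poly_eqI_of_nat:
  fixes p q :: "rat poly"
  assumes "\<And>k. poly p (of_nat k) = poly q (of_nat k)"
  shows "p = q"
proof (rule ccontr)
  assume "p \<noteq> q"
  then have "finite {x. poly (p - q) x = 0}"
    by (intro poly_roots_finite) simp
  moreover have "range of_nat \<subseteq> {x. poly (p - q) x = 0}"
    using assms by auto
  ultimately have "finite (range (of_nat :: nat \<Rightarrow> rat))"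
    by (rule finite_subset[rotated])
  then show False
    using range_inj_infinite[of "of_nat :: nat \<Rightarrow> rat"] by (simp add: inj_of_nat)
qed

lemma tree_specialization:
  assumes T: "T \<in> trees n" and c: "schur_expansion (chromatic_symmetric_function T) c"
    and U: "finite U" "{\<mu>. c \<mu> \<noteq> 0} \<subseteq> U" "\<And>\<mu>. \<mu> \<in> U \<Longrightarrow> sum_list \<mu> = n"
  shows "(\<Sum>\<mu>\<in>U. c \<mu> * of_nat (card (bounded_tableaux k \<mu>))) = of_nat (k * (k - 1) ^ (n - 1))"
proof -
  have "pair_graph T" "card (pverts T) = n"
    using T by (auto simp: trees_def connected_graphs_def)
  then show ?thesis
    using sum_schur_expansion[OF c U, of k] sum_chromatic_symmetric_function[of T n k]
      card_partial_colorings_tree[OF T, of k] by simp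
qed

lemma trees_nonempty:
  assumes "T \<in> trees n"
  shows "0 < n"
proof -
  have "pverts T \<noteq> {}" "finite (pverts T)" "card (pverts T) = n"
    using assms by (auto simp: trees_def connected_graphs_def Digraph_Component.connected_def
        strongly_connected_def mk_symmetric_def pair_graph_def pair_digraph_def
        pair_fin_digraph_def pair_fin_digraph_axioms_def)
  then show ?thesis by (auto simp: card_gt_0_iff)
qed

text \<open>Agreement at all natural numbers makes the two specializations equal as polynomials,
  which permits evaluation at -1. There the Schur side keeps only the column, with sign (-1)^n, and
  the chromatic polynomial gives -(-2)^(n-1).\<close>

lemma tree_column_coefficient:
  assumes T: "T \<in> trees n" and c: "schur_expansion (chromatic_symmetric_function T) c"
    and hom: "\<And>\<mu>. c \<mu> \<noteq> 0 \<Longrightarrow> sum_list \<mu> = n"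
  shows "c (replicate n 1) = 2 ^ (n - 1)"
proof -
  define U where "U = {\<mu>. c \<mu> \<noteq> 0}"
  have U: "finite U" "\<And>\<mu>. \<mu> \<in> U \<Longrightarrow> is_partition \<mu>" "\<And>\<mu>. \<mu> \<in> U \<Longrightarrow> sum_list \<mu> = n"
    using c hom by (auto simp: U_def schur_expansion_def)
  let ?v = "\<lambda>\<mu>. if \<mu> = replicate n 1 then (- 1) ^ n else 0 :: rat"
  have "\<exists>p :: rat poly. (\<forall>k. poly p (of_nat k) = of_nat (card (bounded_tableaux k \<mu>))) \<and>
      poly p (- 1) = ?v \<mu>" if "\<mu> \<in> U" for \<mu>
  proof -
    have \<mu>: "is_partition \<mu>" "sum_list \<mu> = n" using U that by auto
    have "row_length \<mu> 0 \<le> 1 \<longleftrightarrow> \<mu> = replicate n 1"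
      using partition_first_row_le_1[OF \<mu>(1)] by (simp only: \<mu>(2))
    then show ?thesis
      using gt_patterns_polynomial[of "row_length \<mu>" "length \<mu>"] antimono_row_length[OF \<mu>(1)]
      unfolding card_bounded_tableaux[OF \<mu>(1)] sum_row_length \<mu>(2)
      by (simp only: row_length_eq_0)
  qed
  then obtain P :: "nat list \<Rightarrow> rat poly"
    where P: "\<And>\<mu> k. \<mu> \<in> U \<Longrightarrow> poly (P \<mu>) (of_nat k) = of_nat (card (bounded_tableaux k \<mu>))"
      "\<And>\<mu>. \<mu> \<in> U \<Longrightarrow> poly (P \<mu>) (- 1) = ?v \<mu>"
    by metis
  let ?p = "\<Sum>\<mu>\<in>U. smult (c \<mu>) (P \<mu>)" and ?q = "[:0, 1:] * [:- 1, 1:] ^ (n - 1)"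
  have "poly ?p (of_nat k) = poly ?q (of_nat k)" for k
  proof -
    have "poly ?p (of_nat k) = (\<Sum>\<mu>\<in>U. c \<mu> * of_nat (card (bounded_tableaux k \<mu>)))"
      by (simp add: poly_sum P(1))
    also have "\<dots> = of_nat (k * (k - 1) ^ (n - 1))"
      by (rule tree_specialization[OF T c U(1) _ U(3)]) (simp_all add: U_def)
    \<comment> \<open>At \<open>k = 0\<close> the truncated \<open>k - 1\<close> and the polynomial
      factor disagree, but the factor \<open>k\<close> annihilates both.\<close>
    also have "\<dots> = poly ?q (of_nat k)"
      by (cases k) (simp_all add: algebra_simps)
    finally show ?thesis .
  qed
  then have "?p = ?q"
    by (rule poly_eqI_of_nat)
  then have "poly ?p (- 1) = poly ?q (- 1)"
    by (rule arg_cong)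
  then have "(\<Sum>\<mu>\<in>U. c \<mu> * ?v \<mu>) = - ((- 2) ^ (n - 1))"
    by (simp add: poly_sum P(2))
  moreover have "(\<Sum>\<mu>\<in>U. c \<mu> * ?v \<mu>) = c (replicate n 1) * (- 1) ^ n"
  proof -
    have "(\<Sum>\<mu>\<in>U. c \<mu> * ?v \<mu>)
        = (\<Sum>\<mu>\<in>U. if \<mu> = replicate n 1 then c (replicate n 1) * (- 1) ^ n else 0)"
      by (intro sum.cong) auto
    also have "\<dots> = c (replicate n 1) * (- 1) ^ n"
      using U(1) by (simp add: sum.delta U_def)
    finally show ?thesis .
  qed
  ultimately have eq: "c (replicate n 1) * (- 1) ^ n = - ((- 2) ^ (n - 1))"
    by simp
  have "c (replicate n 1) = c (replicate n 1) * (- 1) ^ n * (- 1) ^ n"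
    by (simp flip: power_add)
  also have "\<dots> = 2 ^ (n - 1)"
    unfolding eq using trees_nonempty[OF T] by (cases n) (simp_all flip: power_mult_distrib)
  finally show ?thesis .
qed

lemma trees_not_geq:
  assumes T1: "T1 \<in> trees n" and T2: "T2 \<in> trees n"
    and geq: "graph_geq_s n T1 T2"
  shows "chromatic_symmetric_function T1 = chromatic_symmetric_function T2"
proof -
  let ?X1 = "chromatic_symmetric_function T1" and ?X2 = "chromatic_symmetric_function T2"
  obtain c1 where c1: "schur_expansion ?X1 c1" "\<And>\<mu>. c1 \<mu> \<noteq> 0 \<Longrightarrow> sum_list \<mu> = n"
    using chromatic_symmetric_function_expansion[of T1 n] T1 by (auto simp: trees_def)
  obtain c2 where c2: "schur_expansion ?X2 c2" "\<And>\<mu>. c2 \<mu> \<noteq> 0 \<Longrightarrow> sum_list \<mu> = n"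
    using chromatic_symmetric_function_expansion[of T2 n] T2 by (auto simp: trees_def)
  define U where "U = {\<mu>. c1 \<mu> \<noteq> 0} \<union> {\<mu>. c2 \<mu> \<noteq> 0}"
  have U: "finite U" "\<And>\<mu>. \<mu> \<in> U \<Longrightarrow> is_partition \<mu>" "\<And>\<mu>. \<mu> \<in> U \<Longrightarrow> sum_list \<mu> = n"
    and sub: "{\<mu>. c1 \<mu> \<noteq> 0} \<subseteq> U" "{\<mu>. c2 \<mu> \<noteq> 0} \<subseteq> U"
    using c1 c2 by (auto simp: U_def schur_expansion_def)
  define d where "d \<mu> = c1 \<mu> - c2 \<mu>" for \<mu>
  \<comment> \<open>Both column coefficients are the same nonzero power of 2, so the quotient in
    \<open>X_s\<close> is 1.\<close>
  have X_s: "X_s n T1 T2 M = ?X1 M - ?X2 M" for M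
    unfolding X_s_def schur_coeff_eq[OF c1(1)] schur_coeff_eq[OF c2(1)]
    using tree_column_coefficient[OF T1 c1] tree_column_coefficient[OF T2 c2] by simp
  have "schur_expansion (X_s n T1 T2) d"
  proof (rule schur_expansionI[OF U(1)])
    show "{\<mu>. d \<mu> \<noteq> 0} \<subseteq> U" by (auto simp: d_def U_def)
    then show "is_partition \<mu>" if "d \<mu> \<noteq> 0" for \<mu> using that U(2) by blast
    show "X_s n T1 T2 M = (\<Sum>\<mu>\<in>U. d \<mu> * schur \<mu> M)" for M
      by (simp add: X_s schur_expansion_sum[OF c1(1) U(1) sub(1)]
          schur_expansion_sum[OF c2(1) U(1) sub(2)] d_def left_diff_distrib sum_subtractf)
  qed
  then have nonneg: "0 \<le> d \<mu>" if "\<mu> \<in> U" for \<mu>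
    using geq U(2)[OF that] unfolding graph_geq_s_def schur_positive_def
    by (simp add: schur_coeff_eq)
  have "(\<Sum>\<mu>\<in>U. d \<mu> * of_nat (card (bounded_tableaux n \<mu>))) = 0"
    using tree_specialization[OF T1 c1(1) U(1) sub(1) U(3), of n]
      tree_specialization[OF T2 c2(1) U(1) sub(2) U(3), of n]
    by (simp add: d_def left_diff_distrib sum_subtractf)
  then have "d \<mu> * of_nat (card (bounded_tableaux n \<mu>)) = 0" if "\<mu> \<in> U" for \<mu>
    using nonneg that U(1) by (subst (asm) sum_nonneg_eq_0_iff) auto
  \<comment> \<open>A partition of \<open>n\<close> has at most \<open>n\<close> rows, so
    \<open>n\<close> is a large enough bound on the entries for every shape in \<open>U\<close> at
    once.\<close>
  moreover have "0 < card (bounded_tableaux n \<mu>)" if "\<mu> \<in> U" for \<mu>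
    unfolding card_bounded_tableaux[OF U(2)[OF that]]
    using card_gt_patterns_pos[OF antimono_row_length[OF U(2)[OF that]], of "length \<mu>" n]
      length_le_sum_list[OF U(2)[OF that]] U(3)[OF that]
    by (simp add: row_length_eq_0)
  ultimately have "d \<mu> = 0" if "\<mu> \<in> U" for \<mu>
    using that by fastforce
  then have "c1 \<mu> = c2 \<mu>" for \<mu>
    by (cases "\<mu> \<in> U") (auto simp: d_def U_def)
  then show ?thesis
    using c1(1) c2(1) unfolding schur_expansion_def by (simp add: fun_eq_iff)
qed

theorem corollary4p7:
  fixes n :: nat
  shows "(tree_classes n :: 'a pair_pre_digraph set set) \<subseteq> S_poset n \<and>
     pairwise (\<lambda>A B. \<not> geq_s n A B) (tree_classes n :: 'a pair_pre_digraph set set) \<and>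
     (\<forall>T\<^sub>1 \<in> trees n. \<forall>T\<^sub>2 \<in> (trees n :: 'a pair_pre_digraph set).
        chromatic_symmetric_function T\<^sub>1 \<noteq> chromatic_symmetric_function T\<^sub>2 \<longrightarrow>
        \<not> graph_geq_s n T\<^sub>1 T\<^sub>2 \<and> \<not> graph_geq_s n T\<^sub>2 T\<^sub>1)"
proof (intro conjI)
  show "(tree_classes n :: 'a pair_pre_digraph set set) \<subseteq> S_poset n"
    by (auto simp: tree_classes_def S_poset_def trees_def intro: quotientI)
  show "pairwise (\<lambda>A B. \<not> geq_s n A B) (tree_classes n :: 'a pair_pre_digraph set set)"
  proof (rule pairwiseI)
    fix A B :: "'a pair_pre_digraph set"
    assume "A \<in> tree_classes n" "B \<in> tree_classes n" and "A \<noteq> B"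
    then obtain T1 T2 where T: "T1 \<in> trees n" "T2 \<in> trees n"
      and AB: "A = csf_equiv n `` {T1}" "B = csf_equiv n `` {T2}"
      by (auto simp: tree_classes_def)
    show "\<not> geq_s n A B"
    proof
      assume "geq_s n A B"
      then obtain G H where "G \<in> A" "H \<in> B" and geq: "graph_geq_s n G H"
        by (auto simp: geq_s_def)
      then have eq: "chromatic_symmetric_function G = chromatic_symmetric_function T1"
        "chromatic_symmetric_function H = chromatic_symmetric_function T2"
        by (auto simp: AB csf_equiv_def)
      \<comment> \<open>The representatives \<open>G\<close> and \<open>H\<close> are not known to
        be trees, but \<open>X_s\<close> depends only on their chromatic symmetric functions, so the
        trees can take their place.\<close>
      then have "X_s n G H = X_s n T1 T2"
        by (intro ext) (simp only: X_s_def eq)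
      then have "chromatic_symmetric_function T1 = chromatic_symmetric_function T2"
        using geq trees_not_geq[OF T] by (simp add: graph_geq_s_def)
      then have "A = B" using T by (auto simp: AB csf_equiv_def trees_def)
      with \<open>A \<noteq> B\<close> show False ..
    qed
  qed
  show "\<forall>T\<^sub>1 \<in> trees n. \<forall>T\<^sub>2 \<in> (trees n :: 'a pair_pre_digraph set).
        chromatic_symmetric_function T\<^sub>1 \<noteq> chromatic_symmetric_function T\<^sub>2 \<longrightarrow>
        \<not> graph_geq_s n T\<^sub>1 T\<^sub>2 \<and> \<not> graph_geq_s n T\<^sub>2 T\<^sub>1"
    using trees_not_geq by metis
qed

end
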